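(* For fixed integers $s\ge 1$ and $k\ge 2$, we have, uniformly for integers $n\ge 1$ and $u_1,\dots,u_{k-1}\ge 1$ with $\gcd(u_i,u_j)=1$ for $1\le i\ne j\le k-1$, $$Q_{s,k}^{(u)}(n) = A_{s,k}\Big(\prod_{i=1}^{k-1} f_{s,k,i}(u_i)\Big) n^s + O\big(\theta(u_1)\, n^{s-1} \log^{\delta(s,k)} n\big),$$ where $$A_{s,k}=\prod_{p}\left[\left(1-\frac1p\right)^{s-k+1}\sum_{m=0}^{k-1}\binom{s}{m}\left(1-\frac1p\right)^{k-1-m}\frac{1}{p^m}\right]$$ (product over all primes $p$), $$f_{s,k,i}(u_i)=\prod_{p\mid u_i}\left(1-\frac{\sum_{m=i}^{k-1}\binom{s}{m}(p-1)^{k-1-m}}{\sum_{m=0}^{k-1}\binom{s}{m}(p-1)^{k-1-m}}\right)$$ (product over the primes $p$ dividing $u_i$), $$\delta(s,k)=\max\left\{\binom{s-1}{i} : i=1,2,\dots,k-1\right\},$$ and $\theta(u_1)$ is the number of squarefree divisors of $u_1$.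
   Context: Positive integers $a_1,\dots,a_s$ are called $k$-wise relatively prime if any $k$ of them are relatively prime, i.e. the greatest common divisor of any $k$ of them (any $k$ distinct indices) is $1$ (a vacuous condition if $k>s$). They are called $i$-wise relatively prime to a positive integer $a$ if the gcd of any $i$ of them (any $i$ distinct indices) is relatively prime to $a$ (vacuous if $i>s$). For a $(k-1)$-tuple of positive integers $u=(u_1,\dots,u_{k-1})$, $Q_{s,k}^{(u)}(n)$ denotes the number of $s$-tuples $(a_1,\dots,a_s)$ of positive integers with $1\le a_1,\dots,a_s\le n$ such that $a_1,\dots,a_s$ are $k$-wise relatively prime and are $i$-wise relatively prime to $u_i$ for each $i=1,2,\dots,k-1$. Here $\log^{\delta} n$ means $(\log n)^{\delta}$, and $\binom{a}{b}=0$ if $b>a\ge 0$. "Uniformly" means that the constant implied by the $O$-symbol depends only on $s$ and $k$, not on $n$ or the $u_i$.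
   Formalization: At n = 1 the factor log n in the error term is replaced by log 2, because log 1 = 0 would force a false equality (e.g. s = k = 2, u_1 = 1: Q = 1 but the main term is 6/π²); for all n ≥ 2 the formula is unchanged. *)

theory Defs
  imports
    "HOL-Analysis.Infinite_Products"
    "HOL-Computational_Algebra.Squarefree"
    "HOL-Library.FuncSet"
begin

definition wise_coprime :: "nat \<Rightarrow> nat \<Rightarrow> (nat \<Rightarrow> nat) \<Rightarrow> bool" where
  "wise_coprime k s a \<longleftrightarrow> (\<forall>I \<subseteq> {1..s}. card I = k \<longrightarrow> Gcd (a ` I) = 1)"

definition wise_coprime_to :: "nat \<Rightarrow> nat \<Rightarrow> (nat \<Rightarrow> nat) \<Rightarrow> nat \<Rightarrow> bool" where
  "wise_coprime_to i s a c \<longleftrightarrow> (\<forall>I \<subseteq> {1..s}. card I = i \<longrightarrow> coprime (Gcd (a ` I)) c)"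

(* Only the values of u at 1, ..., k - 1 matter. *)
definition Q_count :: "nat \<Rightarrow> nat \<Rightarrow> (nat \<Rightarrow> nat) \<Rightarrow> nat \<Rightarrow> nat" where
  "Q_count s k u n = card {a \<in> {1..s} \<rightarrow>\<^sub>E {1..n}.
     wise_coprime k s a \<and> (\<forall>i \<in> {1..k - 1}. wise_coprime_to i s a (u i))}"

(* The exponent s - k + 1 is an integer and is negative when k > s + 1. *)
definition A_factor :: "nat \<Rightarrow> nat \<Rightarrow> nat \<Rightarrow> real" where
  "A_factor s k p =
     (1 - 1 / real p) powi (int s - int k + 1) *
     (\<Sum>m = 0..k - 1. real (s choose m) * (1 - 1 / real p) ^ (k - 1 - m) * (1 / real p ^ m))"

definition A_const :: "nat \<Rightarrow> nat \<Rightarrow> real" where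
  "A_const s k = (\<Prod>p. if prime p then A_factor s k p else 1)"

definition f_factor :: "nat \<Rightarrow> nat \<Rightarrow> nat \<Rightarrow> nat \<Rightarrow> real" where
  "f_factor s k i c = (\<Prod>p \<in> prime_factors c.
     1 - (\<Sum>m = i..k - 1. real (s choose m) * (real p - 1) ^ (k - 1 - m)) /
         (\<Sum>m = 0..k - 1. real (s choose m) * (real p - 1) ^ (k - 1 - m)))"

definition delta_exp :: "nat \<Rightarrow> nat \<Rightarrow> nat" where
  "delta_exp s k = Max ((\<lambda>i. (s - 1) choose i) ` {1..k - 1})"

definition theta :: "nat \<Rightarrow> nat" where
  "theta c = card {d. squarefree d \<and> d dvd c}"

(* The natural logarithm for n \<ge> 2. The value at n = 1 is raised from ln 1 = 0 to ln 2, since an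
   error term n^(s-1) * (ln n)^(delta_exp s k) vanishes at n = 1 for s \<ge> 2 and would force an equality
   that does not hold. *)
definition log_ge2 :: "nat \<Rightarrow> real" where
  "log_ge2 n = ln (real (max n 2))"

end

theory Submission
  imports Defs
begin

text \<open>For a prime \<open>p\<close> let \<open>t p = i\<close> if \<open>p\<close> divides \<open>u i\<close>, and \<open>t p = k\<close> if \<open>p\<close> divides no \<open>u i\<close>. A tuple is
  counted iff every prime \<open>p\<close> divides fewer than \<open>t p\<close> of its entries, and only primes \<open>p \<le> n\<close> matter.
  Expanding the local condition at \<open>p\<close> by inclusion-exclusion over sets of indices turns the
  count into a finite sum of products of \<open>s\<close> floor functions. Dropping the floors gives \<open>n ^ s\<close> times the
  product of the local densities over \<open>p \<le> n\<close>. The error is at most \<open>n ^ (s - 1)\<close> times a product over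
  \<open>p \<le> n\<close> whose factors are \<open>1 + (s - 1) / p + O(1 / p\<^sup>2)\<close>, doubled if \<open>p\<close> divides \<open>u 1\<close>; since
  the product of \<open>1 + 1 / p\<close> is \<open>O(log n)\<close>, this is \<open>O(theta (u 1) * log n ^ (s - 1))\<close>, and \<open>s - 1\<close> is
  one of the binomial coefficients in \<open>delta_exp s k\<close>. The primes \<open>p > n\<close> change the product of the
  densities by \<open>O(theta (u 1) / n)\<close> only.\<close>

subsection \<open>Primes\<close>

lemma prime_dvd_prod_primes_iff:
  fixes A :: "nat set"
  assumes "finite A" "\<And>p. p \<in> A \<Longrightarrow> prime p" "prime q"
  shows "q dvd \<Prod>A \<longleftrightarrow> q \<in> A"
proof -
  have "q dvd \<Prod>A \<longleftrightarrow> (\<exists>p\<in>A. q dvd p)"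
    using prime_dvd_prod_iff[OF assms(1,3), of "\<lambda>p. p"] by simp
  then show ?thesis
    using assms primes_dvd_imp_eq by blast
qed

lemma prod_primes_dvd_iff:
  fixes A :: "nat set"
  assumes "finite A" "\<And>p. p \<in> A \<Longrightarrow> prime p"
  shows "\<Prod>A dvd m \<longleftrightarrow> (\<forall>p\<in>A. p dvd m)"
  using assms
proof (induction A rule: finite_induct)
  case (insert p A)
  have "coprime p (\<Prod>A)"
    using insert by (intro prime_imp_coprime) (auto simp: prime_dvd_prod_primes_iff)
  then have "p * \<Prod>A dvd m \<longleftrightarrow> p dvd m \<and> \<Prod>A dvd m"
    by (meson divides_mult dvd_mult_left dvd_mult_right)
  then show ?case
    using insert by simp
qed simp

text \<open>A set of primes is recovered from its product as the set of prime divisors. Sums over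
  subsets can thus be read as sums over squarefree numbers.\<close>

lemma inj_on_prod_primes:
  assumes "finite (A :: nat set)" "\<And>p. p \<in> A \<Longrightarrow> prime p"
  shows "inj_on (\<lambda>X. \<Prod>X) (Pow A)"
proof (rule inj_onI)
  fix X Y assume XY: "X \<in> Pow A" "Y \<in> Pow A" "\<Prod>X = \<Prod>Y"
  then have fin: "finite X" "finite Y" and pr: "\<And>p. p \<in> X \<Longrightarrow> prime p" "\<And>p. p \<in> Y \<Longrightarrow> prime p"
    using assms finite_subset by auto
  have "p \<in> X \<longleftrightarrow> p \<in> Y" for p
    using prime_dvd_prod_primes_iff[OF fin(1) pr(1)] prime_dvd_prod_primes_iff[OF fin(2) pr(2)] pr XY(3)
    by metis
  then show "X = Y" by blast
qed

lemma card_multiples: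
  fixes d n :: nat
  assumes "d > 0"
  shows "card {a \<in> {1..n}. d dvd a} = n div d"
proof -
  have "{a \<in> {1..n}. d dvd a} = (\<lambda>m. d * m) ` {1..n div d}"
  proof (intro equalityI subsetI)
    fix a assume a: "a \<in> {a \<in> {1..n}. d dvd a}"
    then obtain m where m: "a = d * m" by auto
    with a assms have "m \<in> {1..n div d}"
      by (auto simp: less_eq_div_iff_mult_less_eq mult.commute Suc_le_eq)
    with m show "a \<in> (\<lambda>m. d * m) ` {1..n div d}" by blast
  qed (use assms in \<open>auto simp: less_eq_div_iff_mult_less_eq mult.commute Suc_le_eq\<close>)
  moreover have "inj_on (\<lambda>m. d * m) {1..n div d}"
    using assms by (auto intro: inj_onI)
  ultimately show ?thesis by (simp add: card_image)
qed

text \<open>Distinct subsets of \<open>D\<close> have distinct products, and each product is a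
  squarefree divisor of \<open>c\<close>.\<close>

lemma two_power_card_le_theta:
  assumes "c > 0" "finite D" "\<And>p. p \<in> D \<Longrightarrow> prime p \<and> p dvd c"
  shows "2 ^ card D \<le> theta c"
proof -
  have "\<Prod>X dvd c \<and> squarefree (\<Prod>X)" if "X \<subseteq> D" for X
  proof
    have "finite X" "\<And>p. p \<in> X \<Longrightarrow> prime p"
      using that assms finite_subset by auto
    then show "\<Prod>X dvd c"
      using that assms by (subst prod_primes_dvd_iff) auto
    show "squarefree (\<Prod>X)"
      using that assms(3) by (intro squarefree_prod_coprime) (blast intro: primes_coprime squarefree_prime)+
  qed
  then have "(\<lambda>X. \<Prod>X) ` Pow D \<subseteq> {d. squarefree d \<and> d dvd c}" by auto
  moreover have "finite {d. squarefree d \<and> d dvd c}"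
    using assms(1) by (auto intro: finite_subset[OF _ finite_divisors_nat[of c]])
  ultimately have "card ((\<lambda>X. \<Prod>X) ` Pow D) \<le> theta c"
    unfolding theta_def by (rule card_mono[rotated])
  then show ?thesis
    using assms by (simp add: card_image inj_on_prod_primes card_Pow)
qed

section \<open>A Mertens-type bound for the sum of \<open>ln p / p\<close>\<close>

definition primes_upto :: "nat \<Rightarrow> nat set" where
  "primes_upto n = {p. prime p \<and> p \<le> n}"

lemma finite_primes_upto [simp]: "finite (primes_upto n)"
  by (simp add: primes_upto_def)

text \<open>The primes in \<open>(n, 2n]\<close> divide the central binomial coefficient.\<close>

lemma sum_ln_primes_le:
  "(\<Sum>p | prime p \<and> n < p \<and> p \<le> 2 * n. ln (real p)) \<le> real n * ln 4"
proof -
  let ?A = "{p. prime p \<and> n < p \<and> p \<le> 2 * n}"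
  have fin: "finite ?A" by (rule finite_subset[of _ "{..2 * n}"]) auto
  have pos: "(2 * n) choose n > 0" by simp
  have "\<Prod>?A dvd (2 * n) choose n"
  proof (subst prod_primes_dvd_iff)
    show "\<forall>p\<in>?A. p dvd (2 * n) choose n"
    proof
      fix p assume p: "p \<in> ?A"
      then have "p dvd fact (2 * n)" "\<not> p dvd fact n"
        by (auto simp: prime_dvd_fact_iff)
      moreover have "fact (2 * n) = fact n * fact n * ((2 * n) choose n)"
        using binomial_fact_lemma[of n "2 * n"] by simp
      ultimately show "p dvd (2 * n) choose n"
        using p by (metis (no_types, lifting) mem_Collect_eq prime_dvd_mult_iff)
    qed
  qed (use fin in auto)
  then have "\<Prod>?A \<le> (2 * n) choose n"
    using pos by (intro dvd_imp_le)
  also have "\<dots> \<le> 2 ^ (2 * n)" by (rule binomial_le_pow2)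
  finally have "\<Prod>?A \<le> 4 ^ n" by (simp add: power_mult)
  then have "real (\<Prod>?A) \<le> 4 ^ n"
    by (metis of_nat_le_iff of_nat_numeral of_nat_power)
  moreover have "real (\<Prod>?A) > 0"
    by (auto intro!: prod_pos simp: prime_gt_0_nat)
  ultimately have "ln (real (\<Prod>?A)) \<le> ln (4 ^ n)" by simp
  also have "ln (real (\<Prod>?A)) = (\<Sum>p\<in>?A. ln (real p))"
    using fin by (subst of_nat_prod, subst ln_prod) (auto simp: prime_gt_0_nat)
  finally show ?thesis by (simp add: ln_realpow)
qed

text \<open>Dyadic splitting: for \<open>p\<close> above \<open>2 ^ j\<close> the denominator is at
  least \<open>2 ^ j\<close>, while the numerators of the block up to \<open>2 ^ Suc j\<close> sum
  to at most \<open>2 ^ j * ln 4\<close>. So each block contributes at most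
  \<open>ln 4\<close>.\<close>

lemma sum_ln_div_primes_le:
  "(\<Sum>p\<in>primes_upto (2 ^ j). ln (real p) / real p) \<le> real j * ln 4"
proof (induction j)
  case 0
  have "primes_upto 1 = {}"
    by (auto simp: primes_upto_def dest: prime_ge_2_nat)
  then show ?case by simp
next
  case (Suc j)
  let ?A = "{p::nat. prime p \<and> 2 ^ j < p \<and> p \<le> 2 * 2 ^ j}"
  have split: "primes_upto (2 ^ Suc j) = primes_upto (2 ^ j) \<union> ?A"
    by (auto simp: primes_upto_def)
  have "(\<Sum>p\<in>?A. ln (real p) / real p) \<le> (\<Sum>p\<in>?A. ln (real p) / 2 ^ j)"
  proof (intro sum_mono divide_left_mono)
    fix p assume p: "p \<in> ?A"
    then have "(2::nat) ^ j \<le> p" by simp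
    then show "2 ^ j \<le> real p"
      by (metis of_nat_le_iff of_nat_numeral of_nat_power)
    show "0 \<le> ln (real p)" "0 < real p * 2 ^ j"
      using p prime_ge_1_nat[of p] prime_gt_0_nat[of p] by auto
  qed
  also have "\<dots> \<le> ln 4"
    using sum_ln_primes_le[of "2 ^ j"] by (simp flip: sum_divide_distrib add: field_simps)
  finally have "(\<Sum>p\<in>?A. ln (real p) / real p) \<le> ln 4" .
  moreover have "(\<Sum>p\<in>primes_upto (2 ^ Suc j). ln (real p) / real p) =
      (\<Sum>p\<in>primes_upto (2 ^ j). ln (real p) / real p) + (\<Sum>p\<in>?A. ln (real p) / real p)"
    unfolding split by (rule sum.union_disjoint) (auto simp: primes_upto_def)
  ultimately show ?case
    using Suc.IH by (simp add: algebra_simps)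
qed

lemma sum_ln_div_primes_upto_le:
  assumes "n \<ge> 2"
  shows "(\<Sum>p\<in>primes_upto n. ln (real p) / real p) \<le> 4 * ln (real n)"
proof -
  obtain j where j: "2 ^ j \<le> n" "n < 2 ^ (j + 1)"
    using ex_power_ivl1[of 2 n] assms by auto
  have "(\<Sum>p\<in>primes_upto n. ln (real p) / real p)
      \<le> (\<Sum>p\<in>primes_upto (2 ^ (j + 1)). ln (real p) / real p)"
    using j by (intro sum_mono2) (auto simp: primes_upto_def dest: prime_ge_1_nat)
  also have "\<dots> \<le> real (j + 1) * ln 4"
    by (rule sum_ln_div_primes_le)
  also have "ln (4::real) = 2 * ln 2"
    using ln_realpow[of 2 2] by simp
  also have "real (j + 1) * (2 * ln 2) = 2 * (ln (2 ^ j) + ln 2)"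
    by (simp add: ln_realpow algebra_simps)
  also have "ln ((2::real) ^ j) \<le> ln (real n)"
  proof -
    have "(2::real) ^ j \<le> real n"
      using j(1) by (metis of_nat_le_iff of_nat_numeral of_nat_power)
    then show ?thesis by (intro ln_mono) auto
  qed
  also have "ln (2::real) \<le> ln (real n)"
    using assms by simp
  finally show ?thesis by simp
qed

section \<open>Products over primes and the logarithm\<close>

lemma sum_powr_le:
  fixes \<sigma> :: real
  assumes "\<sigma> > 1"
  shows "(\<Sum>d=1..M. real d powr - \<sigma>) \<le> \<sigma> / (\<sigma> - 1)"
proof -
  \<comment> \<open>The quotient on the right is the integral of \<open>x powr -sigma\<close> from 1
    to \<open>Suc M\<close>. Its negative part carries the induction and is dropped
    afterwards.\<close>
  have "(\<Sum>d=1..Suc M. real d powr - \<sigma>) \<le> 1 + (1 - real (Suc M) powr (1 - \<sigma>)) / (\<sigma> - 1)" for M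
  proof (induction M)
    case (Suc M)
    let ?m = "real (Suc M)"
    \<comment> \<open>By the mean value theorem \<open>z powr -sigma\<close> equals the integral
      over the unit interval starting at \<open>?m\<close>; the new term is the value at the right
      endpoint, hence no larger.\<close>
    obtain z where z: "?m < z" "z < ?m + 1"
      and eq: "(?m + 1) powr (1 - \<sigma>) - ?m powr (1 - \<sigma>) = (?m + 1 - ?m) * ((1 - \<sigma>) * z powr - \<sigma>)"
      using MVT2[of ?m "?m + 1" "\<lambda>x. x powr (1 - \<sigma>)" "\<lambda>x. (1 - \<sigma>) * x powr - \<sigma>"]
      by (force intro!: derivative_eq_intros)
    have "(?m + 1) powr - \<sigma> \<le> z powr - \<sigma>"
      using z assms by (intro powr_mono2') auto
    also have "z powr - \<sigma> = (?m powr (1 - \<sigma>) - (?m + 1) powr (1 - \<sigma>)) / (\<sigma> - 1)"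
      using eq assms by (simp add: field_simps)
    finally have "real (Suc (Suc M)) powr - \<sigma>
        \<le> (?m powr (1 - \<sigma>) - real (Suc (Suc M)) powr (1 - \<sigma>)) / (\<sigma> - 1)"
      by (simp add: add.commute)
    then show ?case
      using Suc.IH by (simp add: diff_divide_distrib)
  qed simp
  then have "(\<Sum>d=1..Suc M. real d powr - \<sigma>) \<le> 1 + 1 / (\<sigma> - 1)"
    using assms by (smt (verit, best) divide_right_mono powr_ge_zero)
  also have "\<dots> = \<sigma> / (\<sigma> - 1)"
    using assms by (simp add: field_simps)
  finally have "(\<Sum>d=1..Suc M. real d powr - \<sigma>) \<le> \<sigma> / (\<sigma> - 1)" .
  moreover have "(\<Sum>d=1..M. real d powr - \<sigma>) \<le> (\<Sum>d=1..Suc M. real d powr - \<sigma>)"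
    by (intro sum_mono2) auto
  ultimately show ?thesis by linarith
qed

text \<open>Multiplied out, the product is a sum of \<open>d powr -sigma\<close> over the products
  \<open>d\<close> of subsets of \<open>A\<close>. These \<open>d\<close> are distinct, so the sum
  over all integers up to the product of \<open>A\<close> dominates.\<close>

lemma prod_primes_powr_le:
  fixes \<sigma> :: real
  assumes "\<sigma> > 1" "finite A" "\<And>p. p \<in> A \<Longrightarrow> prime p"
  shows "(\<Prod>p\<in>A. 1 + real p powr - \<sigma>) \<le> \<sigma> / (\<sigma> - 1)"
proof -
  have "(\<Prod>p\<in>A. 1 + real p powr - \<sigma>) = (\<Prod>p\<in>A. real p powr - \<sigma> + 1)"
    by (simp add: add.commute)
  also have "\<dots> = (\<Sum>X\<in>Pow A. \<Prod>p\<in>X. real p powr - \<sigma>)"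
    using assms by (simp add: prod_add)
  also have "\<dots> = (\<Sum>X\<in>Pow A. real (\<Prod>X) powr - \<sigma>)"
    by (intro sum.cong) (auto simp: prod_powr_distrib)
  also have "\<dots> = (\<Sum>d\<in>(\<lambda>X. \<Prod>X) ` Pow A. real d powr - \<sigma>)"
    using assms by (subst sum.reindex) (auto intro: inj_on_prod_primes)
  also have "\<dots> \<le> (\<Sum>d=1..\<Prod>A. real d powr - \<sigma>)"
  proof (rule sum_mono2)
    show "(\<lambda>X. \<Prod>X) ` Pow A \<subseteq> {1..\<Prod>A}"
    proof (clarsimp, intro conjI)
      fix X assume "X \<subseteq> A"
      then have "\<And>p. p \<in> X \<Longrightarrow> prime p" "\<And>p. p \<in> A \<Longrightarrow> prime p"
        using assms by auto
      then have "\<Prod>X > 0" "\<Prod>A > 0"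
        by (auto simp: prime_gt_0_nat intro!: prod_pos)
      moreover have "\<Prod>X dvd \<Prod>A"
        using \<open>X \<subseteq> A\<close> assms(2) by (intro prod_dvd_prod_subset) auto
      ultimately show "Suc 0 \<le> \<Prod>X" "\<Prod>X \<le> \<Prod>A"
        by (auto simp: dvd_imp_le)
    qed
  qed auto
  also have "\<dots> \<le> \<sigma> / (\<sigma> - 1)"
    using assms(1) by (rule sum_powr_le)
  finally show ?thesis .
qed

text \<open>Rankin's trick: at \<open>\<sigma> = 1 + 1 / ln n\<close> the product \<open>\<Prod>(1 + p powr -\<sigma>)\<close> is at most \<open>1 + ln n\<close>,
  and replacing \<open>1/p\<close> by \<open>p powr -\<sigma>\<close> costs a factor \<open>exp (\<Sum> ln p / (p ln n)) = O(1)\<close>.\<close>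

lemma prod_primes_upto_le_ln:
  assumes "n \<ge> 2"
  shows "(\<Prod>p\<in>primes_upto n. 1 + 1 / real p) \<le> exp 4 * (1 + ln (real n))"
proof -
  let ?P = "primes_upto n"
  define L where "L = ln (real n)"
  define \<sigma> where "\<sigma> = 1 + 1 / L"
  have L: "L > 0" using assms by (simp add: L_def)
  have \<sigma>: "\<sigma> > 1" using L by (simp add: \<sigma>_def)
  have diff: "0 \<le> 1 / real p - real p powr - \<sigma>" "1 / real p - real p powr - \<sigma> \<le> ln p / p / L"
    if "p \<in> ?P" for p
  proof -
    have p: "p \<ge> 2" using that by (auto simp: primes_upto_def dest: prime_ge_2_nat)
    have "real p powr - \<sigma> = real p powr - 1 * real p powr - (1 / L)"
      unfolding \<sigma>_def powr_add[symmetric] by simp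
    moreover have "real p powr - 1 = 1 / real p" "real p powr - (1 / L) = exp (- (ln p / L))"
      using p by (simp_all add: powr_minus_divide, simp add: powr_def exp_minus inverse_eq_divide)
    ultimately have "real p powr - \<sigma> = 1 / real p * exp (- (ln p / L))"
      by simp
    moreover have "exp (- (ln p / L)) \<le> 1" "1 - ln p / L \<le> exp (- (ln p / L))"
      using p L exp_ge_add_one_self[of "- (ln p / L)"] by auto
    ultimately show "0 \<le> 1 / real p - real p powr - \<sigma>" "1 / real p - real p powr - \<sigma> \<le> ln p / p / L"
      using p by (auto simp: field_simps)
  qed
  have "(\<Prod>p\<in>?P. 1 + 1 / real p)
      \<le> (\<Prod>p\<in>?P. (1 + real p powr - \<sigma>) * (1 + (1 / real p - real p powr - \<sigma>)))"
  proof (rule prod_mono)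
    fix p assume p: "p \<in> ?P"
    \<comment> \<open>The two factors multiply to \<open>1 + 1 / p\<close> plus this cross
      term.\<close>
    have "0 \<le> real p powr - \<sigma> * (1 / real p - real p powr - \<sigma>)"
      using diff[OF p] by simp
    then have "1 + 1 / real p \<le> (1 + real p powr - \<sigma>) * (1 + (1 / real p - real p powr - \<sigma>))"
      by (simp add: algebra_simps)
    then show "0 \<le> 1 + 1 / real p \<and>
      1 + 1 / real p \<le> (1 + real p powr - \<sigma>) * (1 + (1 / real p - real p powr - \<sigma>))"
      by simp
  qed
  also have "\<dots> = (\<Prod>p\<in>?P. 1 + real p powr - \<sigma>) * (\<Prod>p\<in>?P. 1 + (1 / real p - real p powr - \<sigma>))"
    by (rule prod.distrib)
  also have "\<dots> \<le> (\<sigma> / (\<sigma> - 1)) * exp 4"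
  proof (rule mult_mono)
    show "(\<Prod>p\<in>?P. 1 + real p powr - \<sigma>) \<le> \<sigma> / (\<sigma> - 1)"
      using \<sigma> by (intro prod_primes_powr_le) (auto simp: primes_upto_def)
    have "(\<Prod>p\<in>?P. 1 + (1 / real p - real p powr - \<sigma>)) \<le> exp (\<Sum>p\<in>?P. 1 / real p - real p powr - \<sigma>)"
      using diff by (intro prod_le_exp_sum)
    also have "(\<Sum>p\<in>?P. 1 / real p - real p powr - \<sigma>) \<le> (\<Sum>p\<in>?P. ln p / p / L)"
      using diff by (intro sum_mono)
    also have "\<dots> = (\<Sum>p\<in>?P. ln p / p) / L"
      by (simp add: sum_divide_distrib)
    also have "\<dots> \<le> 4"
      using sum_ln_div_primes_upto_le[OF assms] L by (simp add: L_def field_simps)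
    finally show "(\<Prod>p\<in>?P. 1 + (1 / real p - real p powr - \<sigma>)) \<le> exp 4" by simp
    show "0 \<le> \<sigma> / (\<sigma> - 1)" using \<sigma> by simp
    show "0 \<le> (\<Prod>p\<in>?P. 1 + (1 / real p - real p powr - \<sigma>))"
      using diff by (intro prod_nonneg) (auto intro: add_nonneg_nonneg)
  qed
  also have "\<sigma> / (\<sigma> - 1) = 1 + L"
    using L by (simp add: \<sigma>_def field_simps)
  finally show ?thesis by (simp add: L_def mult.commute)
qed

lemma prod_primes_upto_le_log_ge2:
  "(\<Prod>p\<in>primes_upto n. 1 + 1 / real p) \<le> 3 * exp 4 * log_ge2 n"
proof -
  have "(\<Prod>p\<in>primes_upto n. 1 + 1 / real p) \<le> (\<Prod>p\<in>primes_upto (max n 2). 1 + 1 / real p)"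
    by (intro prod_mono2) (auto simp: primes_upto_def)
  also have "\<dots> \<le> exp 4 * (1 + log_ge2 n)"
    using prod_primes_upto_le_ln[of "max n 2"] by (simp add: log_ge2_def)
  \<comment> \<open>As \<open>log_ge2 n\<close> is at least \<open>ln 2\<close>, hence at least
    \<open>1 / 2\<close>, the summand 1 is at most \<open>2 * log_ge2 n\<close>.\<close>
  also have "1 + log_ge2 n \<le> 3 * log_ge2 n"
  proof -
    have "1 / 2 \<le> ln (2::real)"
      using ln_le_minus_one[of "1/2::real"] by (simp add: ln_div)
    also have "\<dots> \<le> log_ge2 n" by (simp add: log_ge2_def)
    finally show ?thesis by simp
  qed
  finally show ?thesis by simp
qed

text \<open>Telescoping, since \<open>1 / m ^ 2\<close> is at most
  \<open>1 / (m - 1) - 1 / m\<close>. It serves both the quadratic terms of the sieve error and the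
  primes beyond \<open>n\<close>.\<close>

lemma sum_inverse_squares_le:
  assumes "n \<ge> 1" "n \<le> N"
  shows "(\<Sum>m\<in>{n<..N}. 1 / real m ^ 2) \<le> 1 / real n - 1 / real N"
  using assms(2)
proof (induction N rule: dec_induct)
  case (step N)
  have "{n<..Suc N} = insert (Suc N) {n<..N}" using step by auto
  moreover have "1 / real (Suc N) ^ 2 \<le> 1 / (real N * real (Suc N))"
    using step assms by (intro divide_left_mono) (auto simp: power2_eq_square)
  moreover have "1 / (real N * real (Suc N)) = 1 / real N - 1 / real (Suc N)"
    using step assms by (simp add: field_simps)
  ultimately show ?case using step.IH by simp
qed simp

subsection \<open>Expanding the local condition\<close>

text \<open>The Moebius transform, over the lattice of finite sets, of the indicator of \<open>card T < t\<close>.\<close>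

definition sieve_coeff :: "nat \<Rightarrow> 'a set \<Rightarrow> real" where
  "sieve_coeff t T = (\<Sum>R | R \<subseteq> T \<and> card R < t. (- 1) ^ card (T - R))"

text \<open>The binomial probability of fewer than \<open>t\<close> successes in \<open>s\<close>
  trials. At \<open>x = 1 / p\<close> it is the density of the tuples in which \<open>p\<close>
  divides fewer than \<open>t\<close> entries. For \<open>m > s\<close> the truncated exponent is
  harmless because the binomial coefficient vanishes.\<close>

definition local_density :: "nat \<Rightarrow> nat \<Rightarrow> real \<Rightarrow> real" where
  "local_density s t x = (\<Sum>m<t. real (s choose m) * x ^ m * (1 - x) ^ (s - m))"

text \<open>Interchange the sums over \<open>R\<close> and \<open>T\<close> and write
  \<open>T\<close> as the disjoint union of \<open>R\<close> and \<open>W\<close>; the signed sum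
  over \<open>W\<close> expands the product of the \<open>1 - v j\<close>. Zero-one weights will
  give the indicator of the local condition, constant weights the local density.\<close>

lemma sum_sieve_coeff_prod:
  fixes v :: "'a \<Rightarrow> real"
  assumes "finite J"
  shows "(\<Sum>T\<in>Pow J. sieve_coeff t T * (\<Prod>j\<in>T. v j))
    = (\<Sum>R | R \<subseteq> J \<and> card R < t. (\<Prod>j\<in>R. v j) * (\<Prod>j\<in>J - R. 1 - v j))"
proof -
  have fin: "finite X" if "X \<subseteq> J" for X using that assms finite_subset by auto
  have "(\<Sum>T\<in>Pow J. sieve_coeff t T * (\<Prod>j\<in>T. v j))
      = (\<Sum>T\<in>Pow J. \<Sum>R\<in>{R \<in> Pow J. card R < t \<and> R \<subseteq> T}. (- 1) ^ card (T - R) * (\<Prod>j\<in>T. v j))"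
    unfolding sieve_coeff_def sum_distrib_right by (intro sum.cong) auto
  also have "\<dots> = (\<Sum>T\<in>Pow J. \<Sum>R\<in>{R \<in> {R \<in> Pow J. card R < t}. R \<subseteq> T}. (- 1) ^ card (T - R) * (\<Prod>j\<in>T. v j))"
    by (intro sum.cong) auto
  also have "\<dots> = (\<Sum>R\<in>{R \<in> Pow J. card R < t}. \<Sum>T\<in>{T \<in> Pow J. R \<subseteq> T}. (- 1) ^ card (T - R) * (\<Prod>j\<in>T. v j))"
    using assms by (intro sum.swap_restrict) auto
  also have "\<dots> = (\<Sum>R\<in>{R \<in> Pow J. card R < t}. (\<Prod>j\<in>R. v j) * (\<Prod>j\<in>J - R. 1 - v j))"
  proof (rule sum.cong[OF refl])
    fix R assume "R \<in> {R \<in> Pow J. card R < t}"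
    then have R: "R \<subseteq> J" by auto
    have "(\<Sum>T\<in>{T \<in> Pow J. R \<subseteq> T}. (- 1) ^ card (T - R) * (\<Prod>j\<in>T. v j))
        = (\<Sum>W\<in>Pow (J - R). (- 1) ^ card W * (\<Prod>j\<in>R \<union> W. v j))"
      using R by (intro sum.reindex_bij_witness[of _ "\<lambda>W. R \<union> W" "\<lambda>T. T - R"])
        (auto simp: Un_absorb1 Un_Diff intro!: arg_cong[where f = card])
    also have "\<dots> = (\<Sum>W\<in>Pow (J - R). (\<Prod>j\<in>R. v j) * ((- 1) ^ card W * (\<Prod>j\<in>W. v j)))"
    proof (rule sum.cong[OF refl])
      fix W assume "W \<in> Pow (J - R)"
      then have "(\<Prod>j\<in>R \<union> W. v j) = (\<Prod>j\<in>R. v j) * (\<Prod>j\<in>W. v j)"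
        using R fin by (intro prod.union_disjoint) auto
      then show "(- 1) ^ card W * (\<Prod>j\<in>R \<union> W. v j) = (\<Prod>j\<in>R. v j) * ((- 1) ^ card W * (\<Prod>j\<in>W. v j))"
        by simp
    qed
    also have "\<dots> = (\<Prod>j\<in>R. v j) * (\<Prod>j\<in>J - R. 1 - v j)"
      using assms by (simp add: prod_diff_conv_sum sum_distrib_left)
    finally show "(\<Sum>T\<in>{T \<in> Pow J. R \<subseteq> T}. (- 1) ^ card (T - R) * (\<Prod>j\<in>T. v j))
      = (\<Prod>j\<in>R. v j) * (\<Prod>j\<in>J - R. 1 - v j)" .
  qed
  finally show ?thesis by simp
qed

text \<open>With zero-one weights only one \<open>R\<close> survives, the set of all indices
  satisfying \<open>P\<close>.\<close>

lemma sum_sieve_coeff_indicator: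
  assumes "finite J"
  shows "(\<Sum>T\<in>Pow J. sieve_coeff t T * (\<Prod>j\<in>T. of_bool (P j))) = of_bool (card {j \<in> J. P j} < t)"
proof -
  have "(\<Prod>j\<in>R. of_bool (P j)) * (\<Prod>j\<in>J - R. 1 - of_bool (P j)) = (of_bool (R = {j \<in> J. P j}) :: real)"
    if "R \<subseteq> J" for R
  proof -
    have "(\<Prod>j\<in>R. of_bool (P j)) = (of_bool (\<forall>j\<in>R. P j) :: real)"
      "(\<Prod>j\<in>J - R. 1 - of_bool (P j)) = (of_bool (\<forall>j\<in>J - R. \<not> P j) :: real)"
      using that assms finite_subset[of _ J] by (auto simp: of_bool_def prod_zero_iff)
    then show ?thesis using that by auto
  qed
  then have "(\<Sum>T\<in>Pow J. sieve_coeff t T * (\<Prod>j\<in>T. of_bool (P j)))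
      = (\<Sum>R | R \<subseteq> J \<and> card R < t. of_bool (R = {j \<in> J. P j}) :: real)"
    using assms by (simp add: sum_sieve_coeff_prod)
  also have "\<dots> = of_bool (card {j \<in> J. P j} < t)"
    using assms by (simp add: of_bool_def if_distrib sum.delta cong: if_cong)
  finally show ?thesis .
qed

lemma sum_subsets_card:
  assumes "finite J"
  shows "(\<Sum>R | R \<subseteq> J \<and> card R < t. g (card R)) = (\<Sum>m<t. real (card J choose m) * g m)"
proof -
  have "(\<Sum>R | R \<subseteq> J \<and> card R < t. g (card R))
      = (\<Sum>m<t. \<Sum>R\<in>{R \<in> {R. R \<subseteq> J \<and> card R < t}. card R = m}. g (card R))"
    using assms by (subst sum.group) auto
  also have "\<dots> = (\<Sum>m<t. \<Sum>R | R \<subseteq> J \<and> card R = m. g m)"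
    by (intro sum.cong) auto
  also have "\<dots> = (\<Sum>m<t. real (card J choose m) * g m)"
    using n_subsets[OF assms] by simp
  finally show ?thesis .
qed

lemma sum_sieve_coeff_power:
  assumes "finite J"
  shows "(\<Sum>T\<in>Pow J. sieve_coeff t T * x ^ card T) = local_density (card J) t x"
proof -
  have "(\<Sum>T\<in>Pow J. sieve_coeff t T * x ^ card T)
      = (\<Sum>R | R \<subseteq> J \<and> card R < t. x ^ card R * (1 - x) ^ card (J - R))"
    using sum_sieve_coeff_prod[OF assms, of t "\<lambda>_. x"] by simp
  also have "\<dots> = (\<Sum>R | R \<subseteq> J \<and> card R < t. x ^ card R * (1 - x) ^ (card J - card R))"
    using assms by (intro sum.cong) (auto simp: card_Diff_subset finite_subset)
  also have "\<dots> = local_density (card J) t x"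
    unfolding local_density_def sum_subsets_card[OF assms, where g = "\<lambda>m. x ^ m * (1 - x) ^ (card J - m)"]
    by (simp add: mult.assoc)
  finally show ?thesis .
qed

lemma abs_sieve_coeff_le:
  assumes "finite T"
  shows "\<bar>sieve_coeff t T\<bar> \<le> 2 ^ card T"
proof -
  have "\<bar>sieve_coeff t T\<bar> \<le> (\<Sum>R | R \<subseteq> T \<and> card R < t. 1)"
    unfolding sieve_coeff_def by (rule order_trans[OF sum_abs]) simp
  also have "\<dots> \<le> (\<Sum>R\<in>Pow T. 1)"
    using assms by (intro sum_mono2) auto
  finally show ?thesis using assms by (simp add: card_Pow)
qed

section \<open>Values of the coefficients and weighted sums of their absolute values\<close>

lemma sieve_coeff_empty: "t \<ge> 1 \<Longrightarrow> sieve_coeff t ({} :: 'a set) = 1"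
proof -
  assume "t \<ge> 1"
  then have "{R. R \<subseteq> ({} :: 'a set) \<and> card R < t} = {{}}" by auto
  then show "sieve_coeff t ({} :: 'a set) = 1" unfolding sieve_coeff_def by simp
qed

lemma sieve_coeff_1: "finite T \<Longrightarrow> sieve_coeff 1 T = (- 1) ^ card T"
proof -
  assume "finite T"
  then have "{R. R \<subseteq> T \<and> card R < 1} = {{}}"
    using finite_subset[of _ T] by (auto simp: card_eq_0_iff)
  then show ?thesis by (simp add: sieve_coeff_def)
qed

lemma sum_signed_subsets:
  assumes "finite T" "T \<noteq> {}"
  shows "(\<Sum>R\<in>Pow T. (- 1) ^ card (T - R)) = (0 :: real)"
proof -
  have "(\<Sum>R\<in>Pow T. (- 1) ^ card (T - R)) = (\<Prod>x\<in>T. 1 + (- 1 :: real))"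
    unfolding prod_add[OF assms(1)] by simp
  then show ?thesis using assms by (simp add: card_gt_0_iff)
qed

text \<open>Below the threshold the truncation removes no \<open>R\<close>, and the full alternating
  sum is zero. Hence the local density deviates from 1 only at order \<open>x ^ t\<close>.\<close>

lemma sieve_coeff_eq_0:
  assumes "T \<noteq> {}" "finite T" "card T < t"
  shows "sieve_coeff t T = 0"
proof -
  have "{R. R \<subseteq> T \<and> card R < t} = Pow T"
    using assms card_mono[OF assms(2)] by (auto dest: le_less_trans)
  then show ?thesis
    using sum_signed_subsets[OF assms(2,1)] by (simp add: sieve_coeff_def)
qed

text \<open>Here the truncation removes exactly \<open>R = T\<close>, whose sign is
  \<open>+1\<close>.\<close>

lemma sieve_coeff_card_eq:
  assumes "T \<noteq> {}" "finite T" "card T = t"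
  shows "sieve_coeff t T = - 1"
proof -
  have "{R. R \<subseteq> T \<and> card R < t} = Pow T - {T}"
    using assms psubset_card_mono[OF assms(2)] by auto
  then have "sieve_coeff t T = (\<Sum>R\<in>Pow T. (- 1) ^ card (T - R)) - 1"
    using assms by (simp add: sieve_coeff_def sum_diff1)
  then show ?thesis
    using sum_signed_subsets[OF assms(2,1)] by simp
qed

text \<open>The exponent leaves out \<open>j\<close> because the floor error discards the quotient
  at one index \<open>j\<close>. All coefficients have absolute value 1, so the sum factors over the
  indices: \<open>j\<close> gives \<open>1 + 1\<close>, every other index
  \<open>1 + x\<close>.\<close>

lemma sum_abs_sieve_coeff_1:
  assumes "finite J" "j \<in> J"
  shows "(\<Sum>T\<in>Pow J. \<bar>sieve_coeff 1 T\<bar> * x ^ card (T - {j})) = 2 * (1 + x :: real) ^ (card J - 1)"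
proof -
  have "(\<Sum>T\<in>Pow J. \<bar>sieve_coeff 1 T\<bar> * x ^ card (T - {j}))
      = (\<Sum>T\<in>Pow J. (\<Prod>i\<in>T. if i = j then 1 else x) * (\<Prod>i\<in>J - T. 1))"
  proof (rule sum.cong[OF refl])
    fix T assume "T \<in> Pow J"
    then have fin: "finite T" using assms finite_subset by auto
    have "(\<Prod>i\<in>T. if i = j then 1 else x) = (\<Prod>i\<in>T - {j}. x)"
      using fin by (intro prod.mono_neutral_cong_right) auto
    then show "\<bar>sieve_coeff 1 T\<bar> * x ^ card (T - {j}) = (\<Prod>i\<in>T. if i = j then 1 else x) * (\<Prod>i\<in>J - T. 1)"
      using sieve_coeff_1[OF fin] by (simp add: power_abs)
  qed
  also have "\<dots> = (\<Prod>i\<in>J. (if i = j then 1 else x) + 1)"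
    using assms by (simp add: prod_add)
  also have "\<dots> = 2 * (\<Prod>i\<in>J - {j}. (if i = j then 1 else x) + 1)"
    using assms by (simp add: prod.remove)
  also have "(\<Prod>i\<in>J - {j}. (if i = j then 1 else x) + 1) = (\<Prod>i\<in>J - {j}. 1 + x)"
    by (intro prod.cong) auto
  finally show ?thesis using assms by simp
qed

text \<open>Singletons have coefficient 0 since \<open>t\<close> is at least 2, so a linear term in
  \<open>x\<close> can come only from the \<open>card J - 1\<close> pairs \<open>{i, j}\<close>.
  Every other nonempty set with nonzero coefficient has two elements besides \<open>j\<close>; there
  are at most \<open>2 ^ card J\<close> sets with coefficients of absolute value at most
  \<open>2 ^ card J\<close>.\<close>

lemma sum_abs_sieve_coeff_le:
  fixes x :: real
  assumes "finite J" "j \<in> J" "t \<ge> 2" "0 \<le> x" "x \<le> 1"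
  shows "(\<Sum>T\<in>Pow J. \<bar>sieve_coeff t T\<bar> * x ^ card (T - {j})) \<le> 1 + real (card J - 1) * x + 4 ^ card J * x\<^sup>2"
proof -
  let ?E = "(\<lambda>i. {i, j}) ` (J - {j})"
  have term_le: "\<bar>sieve_coeff t T\<bar> * x ^ card (T - {j}) \<le>
      of_bool (T = {}) + of_bool (T \<in> ?E) * x + 2 ^ card J * x\<^sup>2" if "T \<in> Pow J" for T
  proof -
    have fin: "finite T" using that assms finite_subset by auto
    have J: "card T \<le> card J" using that assms by (auto intro: card_mono)
    consider "T = {}" | "T \<noteq> {}" "card T < t" | "T \<in> ?E" "card T \<ge> t" | "T \<noteq> {}" "card T \<ge> t" "T \<notin> ?E"
      by fastforce
    then show ?thesis
    proof cases
      case 1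
      then show ?thesis using assms by (auto simp: sieve_coeff_empty)
    next
      case 2
      then show ?thesis using assms fin by (simp add: sieve_coeff_eq_0)
    next
      case 3
      then obtain i where "i \<noteq> j" "T = {i, j}" by auto
      then have c: "card T = 2" "T \<noteq> {}" "card (T - {j}) = 1" by auto
      \<comment> \<open>A pair of size at least \<open>t\<close> forces \<open>t = 2\<close>, so the
        coefficient is \<open>-1\<close>.\<close>
      with 3 assms have "\<bar>sieve_coeff t T\<bar> = 1"
        using sieve_coeff_card_eq[OF c(2) fin, of t] by simp
      then show ?thesis using 3 c by simp
    next
      case 4
      have "2 \<le> card (T - {j})"
      proof (cases "j \<in> T")
        case True
        have "card T \<noteq> 2"
        proof
          assume "card T = 2"
          then obtain i where "T = {i, j}" "i \<noteq> j"
            using True by (auto simp: card_2_iff)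
          then show False using 4 that by auto
        qed
        then show ?thesis using 4 True fin assms by simp
      next
        case False
        then show ?thesis using 4 assms by simp
      qed
      then have "x ^ card (T - {j}) \<le> x\<^sup>2"
        using assms by (intro power_decreasing) auto
      moreover have "\<bar>sieve_coeff t T\<bar> \<le> 2 ^ card J"
        using J by (intro order_trans[OF abs_sieve_coeff_le[OF fin]] power_increasing) auto
      ultimately have "\<bar>sieve_coeff t T\<bar> * x ^ card (T - {j}) \<le> 2 ^ card J * x\<^sup>2"
        using assms by (intro mult_mono) auto
      then show ?thesis using 4 by simp
    qed
  qed
  have "(\<Sum>T\<in>Pow J. \<bar>sieve_coeff t T\<bar> * x ^ card (T - {j}))
      \<le> (\<Sum>T\<in>Pow J. of_bool (T = {}) + of_bool (T \<in> ?E) * x + 2 ^ card J * x\<^sup>2)"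
    by (rule sum_mono[OF term_le])
  also have "\<dots> = (\<Sum>T\<in>Pow J. of_bool (T = {})) + (\<Sum>T\<in>Pow J. of_bool (T \<in> ?E)) * x + 4 ^ card J * x\<^sup>2"
    using assms by (simp add: sum.distrib sum_distrib_right card_Pow power_mult_distrib[symmetric])
  also have "(\<Sum>T\<in>Pow J. of_bool (T = {})) = (1 :: real)"
    using assms by (simp add: of_bool_def)
  also have "(\<Sum>T\<in>Pow J. of_bool (T \<in> ?E)) = real (card (Pow J \<inter> ?E))"
    using assms by (simp add: of_bool_def sum.If_cases)
  also have "Pow J \<inter> ?E = ?E" using assms by auto
  also have "real (card ?E) * x \<le> real (card J - 1) * x"
    using card_image_le[of "J - {j}" "\<lambda>i. {i, j}"] assms by (intro mult_right_mono) auto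
  finally show ?thesis by simp
qed

section \<open>Bounds for the local densities\<close>

lemma local_density_nonneg: "0 \<le> x \<Longrightarrow> x \<le> 1 \<Longrightarrow> 0 \<le> local_density s t x"
  by (auto simp: local_density_def intro!: sum_nonneg)

lemma local_density_le_1:
  assumes "0 \<le> x" "x \<le> 1"
  shows "local_density s t x \<le> 1"
proof -
  have "local_density s t x \<le> (\<Sum>m<max t (Suc s). real (s choose m) * x ^ m * (1 - x) ^ (s - m))"
    unfolding local_density_def using assms by (intro sum_mono2) auto
  also have "\<dots> = (\<Sum>m\<le>s. real (s choose m) * x ^ m * (1 - x) ^ (s - m))"
    by (intro sum.mono_neutral_right) auto
  also have "\<dots> = (x + (1 - x)) ^ s"
    by (rule binomial_ring[symmetric])
  finally show ?thesis by simp
qed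

text \<open>In the expansion by \<open>sieve_coeff\<close> the empty set gives 1 and the other sets
  below size \<open>t\<close> vanish, so every remaining exponent is at least \<open>r\<close>. The
  cases of use are \<open>r = 1\<close> for threshold 1 and \<open>r = 2\<close> for larger
  thresholds.\<close>

lemma one_minus_local_density_le:
  fixes x :: real
  assumes "0 \<le> x" "x \<le> 1" "r \<le> t" "r \<ge> 1"
  shows "1 - local_density s t x \<le> 4 ^ s * x ^ r"
proof -
  let ?J = "{1..s}"
  have "local_density s t x = (\<Sum>T\<in>Pow ?J. sieve_coeff t T * x ^ card T)"
    using sum_sieve_coeff_power[of ?J t x] by simp
  also have "\<dots> = 1 + (\<Sum>T\<in>Pow ?J - {{}}. sieve_coeff t T * x ^ card T)"
    using assms by (subst sum.remove[of _ "{}"]) (auto simp: sieve_coeff_empty)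
  finally have "1 - local_density s t x \<le> \<bar>\<Sum>T\<in>Pow ?J - {{}}. sieve_coeff t T * x ^ card T\<bar>"
    by simp
  also have "\<dots> \<le> (\<Sum>T\<in>Pow ?J - {{}}. \<bar>sieve_coeff t T * x ^ card T\<bar>)"
    by (rule sum_abs)
  also have "\<dots> \<le> (\<Sum>T\<in>Pow ?J - {{}}. 2 ^ s * x ^ r)"
  proof (rule sum_mono)
    fix T assume T: "T \<in> Pow ?J - {{}}"
    then have fin: "finite T" using finite_subset by auto
    show "\<bar>sieve_coeff t T * x ^ card T\<bar> \<le> 2 ^ s * x ^ r"
    proof (cases "card T < t")
      case True
      then show ?thesis using T fin assms by (simp add: sieve_coeff_eq_0)
    next
      case False
      have "card T \<le> s" using T card_mono[of ?J T] by auto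
      then have "\<bar>sieve_coeff t T\<bar> \<le> 2 ^ s"
        by (intro order_trans[OF abs_sieve_coeff_le[OF fin]] power_increasing) auto
      moreover have "x ^ card T \<le> x ^ r"
        using assms False by (intro power_decreasing) auto
      ultimately show ?thesis
        using assms by (auto simp: abs_mult intro: mult_mono)
    qed
  qed
  also have "\<dots> \<le> (\<Sum>T\<in>Pow ?J. 2 ^ s * x ^ r)"
    using assms by (intro sum_mono2) auto
  also have "\<dots> = 4 ^ s * x ^ r"
    by (simp add: card_Pow power_mult_distrib[symmetric])
  finally show ?thesis .
qed

subsection \<open>Counting tuples\<close>

text \<open>Replacing one factor at a time costs at most 1 at that index, while the other factors
  stay below the \<open>y l\<close>. In the application \<open>x j\<close> is the floor of the
  quotient \<open>y j\<close>.\<close>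

lemma abs_prod_diff_le:
  fixes x y :: "'a \<Rightarrow> real"
  assumes "finite J" "\<And>j. j \<in> J \<Longrightarrow> 0 \<le> x j \<and> x j \<le> y j \<and> y j - x j \<le> 1"
  shows "\<bar>(\<Prod>j\<in>J. x j) - (\<Prod>j\<in>J. y j)\<bar> \<le> (\<Sum>j\<in>J. \<Prod>l\<in>J - {j}. y l)"
  using assms
proof (induction J rule: finite_induct)
  case (insert i J)
  let ?X = "\<Prod>j\<in>J. x j" and ?Y = "\<Prod>j\<in>J. y j"
  have y0: "0 \<le> y i" using insert.prems[of i] by auto
  have X: "0 \<le> ?X" "?X \<le> ?Y"
    using insert.prems by (auto intro!: prod_nonneg prod_mono)
  have "x i * ?X - y i * ?Y = y i * (?X - ?Y) - (y i - x i) * ?X"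
    by (simp add: algebra_simps)
  then have "\<bar>x i * ?X - y i * ?Y\<bar> \<le> y i * \<bar>?X - ?Y\<bar> + \<bar>(y i - x i) * ?X\<bar>"
    using abs_triangle_ineq4[of "y i * (?X - ?Y)" "(y i - x i) * ?X"] y0 by (simp add: abs_mult)
  also have "\<bar>(y i - x i) * ?X\<bar> \<le> 1 * ?Y"
    unfolding abs_mult using insert.prems[of i] X by (intro mult_mono) auto
  also have "y i * \<bar>?X - ?Y\<bar> \<le> y i * (\<Sum>j\<in>J. \<Prod>l\<in>J - {j}. y l)"
    using insert y0 by (intro mult_left_mono) auto
  also have "\<dots> = (\<Sum>j\<in>J. \<Prod>l\<in>insert i J - {j}. y l)"
    unfolding sum_distrib_left
  proof (rule sum.cong[OF refl])
    fix j assume "j \<in> J"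
    then have "insert i J - {j} = insert i (J - {j})" using insert.hyps by auto
    then show "y i * (\<Prod>l\<in>J - {j}. y l) = (\<Prod>l\<in>insert i J - {j}. y l)"
      using insert.hyps by simp
  qed
  finally show ?case
    using insert.hyps by simp
qed simp

text \<open>The function \<open>\<tau>\<close> prescribes for each prime \<open>p\<close> a set of
  indices whose entries \<open>p\<close> has to divide. Read by index, the entry at \<open>j\<close>
  must be divisible by the product of all \<open>p\<close> with \<open>j\<close> in
  \<open>\<tau> p\<close>, so the entries can be counted independently.\<close>

lemma sieve_count_expand:
  fixes P :: "nat set" and s :: nat
  assumes "finite P" "\<And>p. p \<in> P \<Longrightarrow> prime p"
  shows "real (card {a \<in> {1..s} \<rightarrow>\<^sub>E {1..n}. \<forall>p\<in>P. card {j \<in> {1..s}. p dvd a j} < t p})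
    = (\<Sum>\<tau>\<in>P \<rightarrow>\<^sub>E Pow {1..s}. (\<Prod>p\<in>P. sieve_coeff (t p) (\<tau> p)) * (\<Prod>j\<in>{1..s}. real (n div \<Prod>{p \<in> P. j \<in> \<tau> p})))"
proof -
  define J where "J = {1..s}"
  let ?F = "J \<rightarrow>\<^sub>E {1..n}" and ?G = "P \<rightarrow>\<^sub>E Pow J"
  have finJ: "finite J" by (simp add: J_def)
  have finF: "finite ?F" by (intro finite_PiE) (auto simp: J_def)
  have swap: "(\<Prod>p\<in>P. \<Prod>j\<in>\<tau> p. of_bool (p dvd a j)) = (\<Prod>j\<in>J. of_bool (\<Prod>{p \<in> P. j \<in> \<tau> p} dvd a j) :: real)"
    if "\<tau> \<in> ?G" for \<tau> a
  proof -
    have "(\<Prod>p\<in>P. \<Prod>j\<in>\<tau> p. of_bool (p dvd a j)) = (\<Prod>p\<in>P. \<Prod>j\<in>{j \<in> J. j \<in> \<tau> p}. of_bool (p dvd a j) :: real)"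
      using that by (intro prod.cong) (auto simp: PiE_iff)
    also have "\<dots> = (\<Prod>j\<in>J. \<Prod>p\<in>{p \<in> P. j \<in> \<tau> p}. of_bool (p dvd a j))"
      using assms(1) finJ by (intro prod.swap_restrict)
    also have "\<dots> = (\<Prod>j\<in>J. of_bool (\<Prod>{p \<in> P. j \<in> \<tau> p} dvd a j))"
      using assms(1,2) by (intro prod.cong refl, subst prod_primes_dvd_iff) (auto simp: of_bool_def prod_zero_iff)
    finally show ?thesis .
  qed
  have inner: "(\<Sum>b\<in>{1..n}. of_bool (\<Prod>{p \<in> P. j \<in> \<tau> p} dvd b)) = real (n div \<Prod>{p \<in> P. j \<in> \<tau> p})" for \<tau> j
  proof -
    have "\<Prod>{p \<in> P. j \<in> \<tau> p} > 0"
      using assms(2) by (auto simp: prime_gt_0_nat intro!: prod_pos)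
    then have "real (card {b \<in> {1..n}. \<Prod>{p \<in> P. j \<in> \<tau> p} dvd b}) = real (n div \<Prod>{p \<in> P. j \<in> \<tau> p})"
      using card_multiples by simp
    then show ?thesis by (simp add: of_bool_def sum.If_cases Int_def)
  qed
  have "real (card {a \<in> ?F. \<forall>p\<in>P. card {j \<in> J. p dvd a j} < t p})
      = (\<Sum>a\<in>?F. of_bool (\<forall>p\<in>P. card {j \<in> J. p dvd a j} < t p))"
    using finF by (simp add: of_bool_def sum.If_cases Int_def)
  also have "\<dots> = (\<Sum>a\<in>?F. \<Prod>p\<in>P. of_bool (card {j \<in> J. p dvd a j} < t p))"
    using assms(1) by (intro sum.cong) (auto simp: of_bool_def prod_zero_iff)
  also have "\<dots> = (\<Sum>a\<in>?F. \<Prod>p\<in>P. \<Sum>T\<in>Pow J. sieve_coeff (t p) T * (\<Prod>j\<in>T. of_bool (p dvd a j)))"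
    by (simp only: sum_sieve_coeff_indicator[OF finJ])
  also have "\<dots> = (\<Sum>a\<in>?F. \<Sum>\<tau>\<in>?G. \<Prod>p\<in>P. sieve_coeff (t p) (\<tau> p) * (\<Prod>j\<in>\<tau> p. of_bool (p dvd a j)))"
    using assms(1) finJ by (subst prod_sum_PiE) auto
  also have "\<dots> = (\<Sum>\<tau>\<in>?G. \<Sum>a\<in>?F. \<Prod>p\<in>P. sieve_coeff (t p) (\<tau> p) * (\<Prod>j\<in>\<tau> p. of_bool (p dvd a j)))"
    by (rule sum.swap)
  also have "\<dots> = (\<Sum>\<tau>\<in>?G. (\<Prod>p\<in>P. sieve_coeff (t p) (\<tau> p)) *
      (\<Sum>a\<in>?F. \<Prod>j\<in>J. of_bool (\<Prod>{p \<in> P. j \<in> \<tau> p} dvd a j)))"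
    by (simp add: prod.distrib swap sum_distrib_left)
  \<comment> \<open>The distributive law in the other direction: the sum over tuples of a product
    over coordinates is a product of sums over single entries.\<close>
  also have "\<dots> = (\<Sum>\<tau>\<in>?G. (\<Prod>p\<in>P. sieve_coeff (t p) (\<tau> p)) *
      (\<Prod>j\<in>J. \<Sum>b\<in>{1..n}. of_bool (\<Prod>{p \<in> P. j \<in> \<tau> p} dvd b)))"
    using finJ by (subst prod_sum_PiE) auto
  finally show ?thesis by (simp only: inner J_def)
qed

text \<open>Without floors, the sum over \<open>\<tau>\<close> factors over the primes into local
  densities. The floor error is a sum over one discarded index \<open>j\<close>, and for fixed
  \<open>j\<close> the sum of absolute values factors over the primes again.\<close>

lemma sieve_count_estimate:
  fixes P :: "nat set"
  assumes "finite P" "\<And>p. p \<in> P \<Longrightarrow> prime p"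
  shows "\<bar>real (card {a \<in> {1..s} \<rightarrow>\<^sub>E {1..n}. \<forall>p\<in>P. card {j \<in> {1..s}. p dvd a j} < t p})
      - real n ^ s * (\<Prod>p\<in>P. local_density s (t p) (1 / real p))\<bar>
    \<le> real n ^ (s - 1) * (\<Sum>j\<in>{1..s}. \<Prod>p\<in>P. \<Sum>T\<in>Pow {1..s}. \<bar>sieve_coeff (t p) T\<bar> * (1 / real p) ^ card (T - {j}))"
proof -
  let ?J = "{1..s}"
  let ?G = "P \<rightarrow>\<^sub>E Pow ?J"
  define c where "c \<tau> = (\<Prod>p\<in>P. sieve_coeff (t p) (\<tau> p))" for \<tau> :: "nat \<Rightarrow> nat set"
  define D where "D \<tau> j = \<Prod>{p \<in> P. j \<in> \<tau> p}" for \<tau> :: "nat \<Rightarrow> nat set" and j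
  \<comment> \<open>Taking for \<open>K\<close> all indices gives the main term, and all indices but
    \<open>j\<close> the error term.\<close>
  have prod_D: "(\<Prod>l\<in>K. real n / real (D \<tau> l)) = real n ^ card K * (\<Prod>p\<in>P. (1 / real p) ^ card (\<tau> p \<inter> K))"
    if "\<tau> \<in> ?G" "K \<subseteq> ?J" for \<tau> K
  proof -
    have K: "finite K" using that by (auto intro: finite_subset)
    have "(\<Prod>l\<in>K. real n / real (D \<tau> l)) = (\<Prod>l\<in>K. real n * (\<Prod>p\<in>{p \<in> P. l \<in> \<tau> p}. 1 / real p))"
      by (simp add: D_def prod_dividef)
    also have "\<dots> = real n ^ card K * (\<Prod>l\<in>K. \<Prod>p\<in>{p \<in> P. l \<in> \<tau> p}. 1 / real p)"
      by (simp add: prod.distrib)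
    also have "(\<Prod>l\<in>K. \<Prod>p\<in>{p \<in> P. l \<in> \<tau> p}. 1 / real p) = (\<Prod>p\<in>P. \<Prod>l\<in>{l \<in> K. l \<in> \<tau> p}. 1 / real p)"
      using K assms(1) by (intro prod.swap_restrict)
    also have "\<dots> = (\<Prod>p\<in>P. (1 / real p) ^ card (\<tau> p \<inter> K))"
      by (simp add: Int_def conj_commute)
    finally show ?thesis .
  qed
  have main: "(\<Sum>\<tau>\<in>?G. c \<tau> * (\<Prod>j\<in>?J. real n / real (D \<tau> j)))
      = real n ^ s * (\<Prod>p\<in>P. local_density s (t p) (1 / real p))"
  proof -
    have "(\<Sum>\<tau>\<in>?G. c \<tau> * (\<Prod>j\<in>?J. real n / real (D \<tau> j)))
        = (\<Sum>\<tau>\<in>?G. real n ^ s * (\<Prod>p\<in>P. sieve_coeff (t p) (\<tau> p) * (1 / real p) ^ card (\<tau> p)))"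
    proof (rule sum.cong[OF refl])
      fix \<tau> assume \<tau>: "\<tau> \<in> ?G"
      then have "(\<Prod>p\<in>P. (1 / real p) ^ card (\<tau> p \<inter> ?J)) = (\<Prod>p\<in>P. (1 / real p) ^ card (\<tau> p))"
        by (intro prod.cong refl) (auto simp: PiE_iff Int_absorb2)
      then show "c \<tau> * (\<Prod>j\<in>?J. real n / real (D \<tau> j))
        = real n ^ s * (\<Prod>p\<in>P. sieve_coeff (t p) (\<tau> p) * (1 / real p) ^ card (\<tau> p))"
        unfolding prod_D[OF \<tau> order_refl] by (simp add: c_def prod.distrib)
    qed
    also have "\<dots> = real n ^ s * (\<Prod>p\<in>P. \<Sum>T\<in>Pow ?J. sieve_coeff (t p) T * (1 / real p) ^ card T)"
      using assms(1) by (subst prod_sum_PiE) (auto simp: sum_distrib_left)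
    also have "\<dots> = real n ^ s * (\<Prod>p\<in>P. local_density s (t p) (1 / real p))"
      by (subst sum_sieve_coeff_power) auto
    finally show ?thesis .
  qed
  have floor: "\<bar>(\<Prod>j\<in>?J. real (n div D \<tau> j)) - (\<Prod>j\<in>?J. real n / real (D \<tau> j))\<bar>
      \<le> (\<Sum>j\<in>?J. \<Prod>l\<in>?J - {j}. real n / real (D \<tau> l))" for \<tau>
  proof (rule abs_prod_diff_le)
    fix j
    have "D \<tau> j > 0"
      unfolding D_def using assms(2) by (auto simp: prime_gt_0_nat intro!: prod_pos)
    moreover have "real n = real (D \<tau> j) * real (n div D \<tau> j) + real (n mod D \<tau> j)"
      by (simp flip: of_nat_mult of_nat_add)
    moreover have "real (n mod D \<tau> j) \<le> real (D \<tau> j)"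
      using \<open>D \<tau> j > 0\<close> by (simp add: less_imp_le)
    ultimately show "0 \<le> real (n div D \<tau> j) \<and> real (n div D \<tau> j) \<le> real n / real (D \<tau> j) \<and>
        real n / real (D \<tau> j) - real (n div D \<tau> j) \<le> 1"
      by (simp add: field_simps)
  qed simp
  have expand: "real (card {a \<in> ?J \<rightarrow>\<^sub>E {1..n}. \<forall>p\<in>P. card {j \<in> ?J. p dvd a j} < t p})
      = (\<Sum>\<tau>\<in>?G. c \<tau> * (\<Prod>j\<in>?J. real (n div D \<tau> j)))"
    unfolding c_def D_def by (rule sieve_count_expand[OF assms])
  have "\<bar>real (card {a \<in> ?J \<rightarrow>\<^sub>E {1..n}. \<forall>p\<in>P. card {j \<in> ?J. p dvd a j} < t p})
      - real n ^ s * (\<Prod>p\<in>P. local_density s (t p) (1 / real p))\<bar>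
      = \<bar>\<Sum>\<tau>\<in>?G. c \<tau> * ((\<Prod>j\<in>?J. real (n div D \<tau> j)) - (\<Prod>j\<in>?J. real n / real (D \<tau> j)))\<bar>"
    by (simp only: expand main[symmetric] sum_subtractf right_diff_distrib)
  also have "\<dots> \<le> (\<Sum>\<tau>\<in>?G. \<bar>c \<tau>\<bar> * (\<Sum>j\<in>?J. \<Prod>l\<in>?J - {j}. real n / real (D \<tau> l)))"
    by (rule order_trans[OF sum_abs], rule sum_mono, subst abs_mult, rule mult_left_mono[OF floor abs_ge_zero])
  also have "\<dots> = (\<Sum>\<tau>\<in>?G. \<Sum>j\<in>?J. real n ^ (s - 1) *
      (\<Prod>p\<in>P. \<bar>sieve_coeff (t p) (\<tau> p)\<bar> * (1 / real p) ^ card (\<tau> p - {j})))"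
  proof (rule sum.cong[OF refl])
    fix \<tau> assume \<tau>: "\<tau> \<in> ?G"
    have "\<bar>c \<tau>\<bar> * (\<Prod>l\<in>?J - {j}. real n / real (D \<tau> l)) = real n ^ (s - 1) *
      (\<Prod>p\<in>P. \<bar>sieve_coeff (t p) (\<tau> p)\<bar> * (1 / real p) ^ card (\<tau> p - {j}))" if "j \<in> ?J" for j
    proof -
      have "\<tau> p \<inter> (?J - {j}) = \<tau> p - {j}" if "p \<in> P" for p
        using \<tau> that by (auto simp: PiE_iff)
      then have "(\<Prod>p\<in>P. (1 / real p) ^ card (\<tau> p \<inter> (?J - {j}))) = (\<Prod>p\<in>P. (1 / real p) ^ card (\<tau> p - {j}))"
        by (intro prod.cong) auto
      moreover have "?J - {j} \<subseteq> ?J" by auto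
      ultimately show ?thesis
        using that by (simp add: prod_D[OF \<tau>] c_def prod.distrib abs_prod)
    qed
    then show "\<bar>c \<tau>\<bar> * (\<Sum>j\<in>?J. \<Prod>l\<in>?J - {j}. real n / real (D \<tau> l)) = (\<Sum>j\<in>?J. real n ^ (s - 1) *
      (\<Prod>p\<in>P. \<bar>sieve_coeff (t p) (\<tau> p)\<bar> * (1 / real p) ^ card (\<tau> p - {j})))"
      by (simp add: sum_distrib_left)
  qed
  also have "\<dots> = (\<Sum>j\<in>?J. real n ^ (s - 1) * (\<Sum>\<tau>\<in>?G.
      \<Prod>p\<in>P. \<bar>sieve_coeff (t p) (\<tau> p)\<bar> * (1 / real p) ^ card (\<tau> p - {j})))"
    by (subst sum.swap) (simp add: sum_distrib_left)
  also have "\<dots> = (\<Sum>j\<in>?J. real n ^ (s - 1) * (\<Prod>p\<in>P. \<Sum>T\<in>Pow ?J. \<bar>sieve_coeff (t p) T\<bar> * (1 / real p) ^ card (T - {j})))"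
    using assms(1) by (subst prod_sum_PiE) auto
  finally show ?thesis
    by (simp add: sum_distrib_left)
qed

text \<open>Bernoulli's inequality absorbs the linear term \<open>(s - 1) / p\<close> into
  \<open>(1 + 1 / p) ^ (s - 1)\<close>, whose product over \<open>p\<close> is bounded by a power of
  the logarithm. The terms of order \<open>1 / p ^ 2\<close> give a bounded product, and each prime
  of threshold 1 costs a factor 2.\<close>

lemma prod_sum_abs_sieve_coeff_le:
  assumes "j \<in> {1..s}" "\<And>p. p \<in> primes_upto n \<Longrightarrow> t p \<ge> 1"
  shows "(\<Prod>p\<in>primes_upto n. \<Sum>T\<in>Pow {1..s}. \<bar>sieve_coeff (t p) T\<bar> * (1 / real p) ^ card (T - {j}))
    \<le> 2 ^ card {p \<in> primes_upto n. t p = 1} * (3 * exp 4 * log_ge2 n) ^ (s - 1) * exp (2 * 4 ^ s)"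
proof -
  let ?P = "primes_upto n"
  have "(\<Prod>p\<in>?P. \<Sum>T\<in>Pow {1..s}. \<bar>sieve_coeff (t p) T\<bar> * (1 / real p) ^ card (T - {j}))
      \<le> (\<Prod>p\<in>?P. (if t p = 1 then 2 else 1) * (1 + 1 / real p) ^ (s - 1) * (1 + 4 ^ s * (1 / real p)\<^sup>2))"
  proof (intro prod_mono conjI)
    fix p assume p: "p \<in> ?P"
    let ?x = "1 / real p"
    have x: "0 \<le> ?x" "?x \<le> 1"
      using p by (auto simp: primes_upto_def dest: prime_ge_1_nat)
    show "0 \<le> (\<Sum>T\<in>Pow {1..s}. \<bar>sieve_coeff (t p) T\<bar> * ?x ^ card (T - {j}))"
      using x by (intro sum_nonneg) auto
    show "(\<Sum>T\<in>Pow {1..s}. \<bar>sieve_coeff (t p) T\<bar> * ?x ^ card (T - {j}))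
      \<le> (if t p = 1 then 2 else 1) * (1 + ?x) ^ (s - 1) * (1 + 4 ^ s * ?x\<^sup>2)"
    proof (cases "t p = 1")
      case True
      have "2 * (1 + ?x) ^ (s - 1) * 1 \<le> 2 * (1 + ?x) ^ (s - 1) * (1 + 4 ^ s * ?x\<^sup>2)"
        by (intro mult_left_mono) auto
      then show ?thesis
        using True sum_abs_sieve_coeff_1[OF _ assms(1), of ?x] by simp
    next
      case False
      then have "t p \<ge> 2" using assms(2)[OF p] by simp
      then have "(\<Sum>T\<in>Pow {1..s}. \<bar>sieve_coeff (t p) T\<bar> * ?x ^ card (T - {j}))
          \<le> 1 + real (s - 1) * ?x + 4 ^ s * ?x\<^sup>2"
        using sum_abs_sieve_coeff_le[OF _ assms(1), of "t p" ?x] x by simp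
      also have "\<dots> \<le> (1 + ?x) ^ (s - 1) + (1 + ?x) ^ (s - 1) * (4 ^ s * ?x\<^sup>2)"
      proof (rule add_mono)
        show "1 + real (s - 1) * ?x \<le> (1 + ?x) ^ (s - 1)"
          using x by (intro Bernoulli_inequality) linarith
        have "1 * (4 ^ s * ?x\<^sup>2) \<le> (1 + ?x) ^ (s - 1) * (4 ^ s * ?x\<^sup>2)"
          using x by (intro mult_right_mono one_le_power) auto
        then show "4 ^ s * ?x\<^sup>2 \<le> (1 + ?x) ^ (s - 1) * (4 ^ s * ?x\<^sup>2)" by simp
      qed
      finally show ?thesis using False by (simp add: algebra_simps)
    qed
  qed
  also have "\<dots> = 2 ^ card {p \<in> ?P. t p = 1} * (\<Prod>p\<in>?P. 1 + 1 / real p) ^ (s - 1) * (\<Prod>p\<in>?P. 1 + 4 ^ s * (1 / real p)\<^sup>2)"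
    by (simp add: prod.distrib prod_power_distrib prod.If_cases Int_def)
  also have "\<dots> \<le> 2 ^ card {p \<in> ?P. t p = 1} * (3 * exp 4 * log_ge2 n) ^ (s - 1) * exp (2 * 4 ^ s)"
  proof (intro mult_mono mult_left_mono power_mono prod_primes_upto_le_log_ge2)
    have "(\<Prod>p\<in>?P. 1 + 4 ^ s * (1 / real p)\<^sup>2) \<le> exp (\<Sum>p\<in>?P. 4 ^ s * (1 / real p)\<^sup>2)"
      by (intro prod_le_exp_sum) auto
    also have "(\<Sum>p\<in>?P. 4 ^ s * (1 / real p)\<^sup>2) \<le> 2 * 4 ^ s"
    proof -
      \<comment> \<open>Primes exceed 1, so integers above 1 suffice; \<open>max n 1\<close> keeps
        the telescoping bound applicable at \<open>n = 0\<close>.\<close>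
      have "(\<Sum>p\<in>?P. (1 / real p)\<^sup>2) \<le> (\<Sum>m\<in>{1<..max n 1}. 1 / (real m)\<^sup>2)"
        unfolding power_one_over
        by (intro sum_mono2) (auto simp: primes_upto_def dest: prime_gt_1_nat)
      also have "\<dots> \<le> 1 / real 1 - 1 / real (max n 1)"
        by (rule sum_inverse_squares_le) auto
      also have "\<dots> \<le> 2"
        using divide_nonneg_nonneg[of 1 "real (max n 1)"] by linarith
      finally show ?thesis by (simp flip: sum_distrib_left)
    qed
    finally show "(\<Prod>p\<in>?P. 1 + 4 ^ s * (1 / real p)\<^sup>2) \<le> exp (2 * 4 ^ s)" by simp
  qed (auto intro!: prod_nonneg mult_nonneg_nonneg zero_le_power add_nonneg_nonneg simp: log_ge2_def)
  finally show ?thesis .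
qed

subsection \<open>The Euler product\<close>

text \<open>With \<open>q = 1 - 1 / p\<close> one has \<open>p - 1 = p * q\<close>, and
  \<open>q ^ (s - m)\<close> splits into \<open>q powi (s - k + 1)\<close> and
  \<open>q ^ (k - 1 - m)\<close>. The prefactor does not depend on \<open>i\<close>, so it cancels
  in ratios of densities.\<close>

lemma local_density_eq_sum:
  fixes p :: nat
  assumes "p \<ge> 2" "i \<le> k" "k \<ge> 1"
  shows "local_density s i (1 / real p) = (1 - 1 / real p) powi (int s - int k + 1) / real p ^ (k - 1) *
    (\<Sum>m<i. real (s choose m) * (real p - 1) ^ (k - 1 - m))"
  unfolding local_density_def sum_distrib_left
proof (rule sum.cong[OF refl])
  fix m assume "m \<in> {..<i}"
  then have m: "m \<le> k - 1" using assms by auto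
  let ?q = "1 - 1 / real p"
  show "real (s choose m) * (1 / real p) ^ m * ?q ^ (s - m) =
    ?q powi (int s - int k + 1) / real p ^ (k - 1) * (real (s choose m) * (real p - 1) ^ (k - 1 - m))"
  \<comment> \<open>For \<open>m > s\<close> the exponents no longer match, but both sides vanish
    with the binomial coefficient.\<close>
  proof (cases "m \<le> s")
    case True
    have q: "?q \<noteq> 0" using assms by (auto simp: field_simps)
    have "int s - int k + 1 + int (k - 1 - m) = int (s - m)"
      using m True assms by linarith
    then have "?q ^ (s - m) = ?q powi (int s - int k + 1) * ?q ^ (k - 1 - m)"
      using q by (metis power_int_add power_int_of_nat)
    moreover have "(real p - 1) ^ (k - 1 - m) = real p ^ (k - 1 - m) * ?q ^ (k - 1 - m)"
      using assms by (simp flip: power_mult_distrib add: field_simps)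
    moreover have "real p ^ (k - 1) = real p ^ (k - 1 - m) * real p ^ m"
      using m by (metis le_add_diff_inverse2 power_add)
    ultimately show ?thesis
      using assms by (simp add: power_one_over field_simps)
  qed (simp add: binomial_eq_0)
qed

lemma A_factor_eq_local_density:
  fixes p :: nat
  assumes "p \<ge> 2" "k \<ge> 1"
  shows "A_factor s k p = local_density s k (1 / real p)"
proof -
  let ?q = "1 - 1 / real p"
  have "(\<Sum>m = 0..k - 1. real (s choose m) * ?q ^ (k - 1 - m) * (1 / real p ^ m))
      = (\<Sum>m<k. real (s choose m) * (real p - 1) ^ (k - 1 - m) / real p ^ (k - 1))"
  proof (rule sum.cong)
    fix m assume "m \<in> {..<k}"
    then have "m \<le> k - 1" by auto
    then have "real p ^ (k - 1) = real p ^ (k - 1 - m) * real p ^ m"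
      by (metis le_add_diff_inverse2 power_add)
    moreover have "(real p - 1) ^ (k - 1 - m) = real p ^ (k - 1 - m) * ?q ^ (k - 1 - m)"
      using assms by (simp flip: power_mult_distrib add: field_simps)
    ultimately show "real (s choose m) * ?q ^ (k - 1 - m) * (1 / real p ^ m) =
        real (s choose m) * (real p - 1) ^ (k - 1 - m) / real p ^ (k - 1)"
      using assms by simp
  qed (use assms in auto)
  then show ?thesis
    unfolding A_factor_def local_density_eq_sum[OF assms(1) order_refl assms(2), of s]
    by (simp only: sum_divide_distrib[symmetric] times_divide_eq_left times_divide_eq_right)
qed

lemma sum_choose_powers_pos:
  fixes p :: nat
  assumes "p \<ge> 2" "k \<ge> 1"
  shows "(\<Sum>m<k. real (s choose m) * (real p - 1) ^ (k - 1 - m)) > 0"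
  using assms by (intro sum_pos2[of _ 0]) auto

lemma local_density_pos:
  fixes p :: nat
  assumes "p \<ge> 2" "k \<ge> 1"
  shows "local_density s k (1 / real p) > 0"
  unfolding local_density_eq_sum[OF assms(1) order_refl assms(2)]
  using assms sum_choose_powers_pos[OF assms, of s] by (intro mult_pos_pos) (auto simp: zero_less_power_int)

text \<open>Removing the part with \<open>m\<close> at least \<open>i\<close> leaves the sum over
  \<open>m < i\<close>. So each factor exchanges the density at threshold \<open>k\<close> for the
  one at threshold \<open>i\<close>.\<close>

lemma f_factor_eq_local_density:
  assumes "1 \<le> i" "i < k"
  shows "f_factor s k i c = (\<Prod>p\<in>prime_factors c. local_density s i (1 / real p) / local_density s k (1 / real p))"
  unfolding f_factor_def
proof (rule prod.cong[OF refl])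
  fix p assume "p \<in> prime_factors c"
  then have p: "p \<ge> 2" by (auto simp: in_prime_factors_iff intro: prime_ge_2_nat)
  let ?S = "\<lambda>M. \<Sum>m\<in>M. real (s choose m) * (real p - 1) ^ (k - 1 - m)"
  let ?c = "(1 - 1 / real p) powi (int s - int k + 1) / real p ^ (k - 1)"
  have k: "{0..k - 1} = {..<k}" "{..<k} = {..<i} \<union> {i..k - 1}" "i \<le> k" "k \<ge> 1" using assms by auto
  have "?S {..<k} = ?S {..<i} + ?S {i..k - 1}"
    unfolding k(2) by (rule sum.union_disjoint) auto
  moreover have "?S {..<k} > 0"
    using p k by (intro sum_choose_powers_pos) auto
  ultimately have ratio: "1 - ?S {i..k - 1} / ?S {0..k - 1} = ?S {..<i} / ?S {..<k}"
    unfolding k(1) by (simp add: field_simps)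
  have c: "?c \<noteq> 0"
  proof -
    have "1 - 1 / real p \<noteq> 0" using p by simp
    then show ?thesis using p by (simp only: divide_eq_0_iff power_int_eq_0_iff power_eq_0_iff) simp
  qed
  show "1 - ?S {i..k - 1} / ?S {0..k - 1} = local_density s i (1 / real p) / local_density s k (1 / real p)"
    unfolding local_density_eq_sum[OF p k(3,4)] local_density_eq_sum[OF p order_refl k(4)]
    unfolding ratio by (rule mult_divide_mult_cancel_left[OF c, symmetric])
qed

text \<open>As \<open>k\<close> is at least 2, the factor at \<open>p\<close> differs from 1 by at
  most \<open>4 ^ s / p ^ 2\<close>. Absolute convergence then identifies the infinite product with
  the limit of its partial products.\<close>

lemma LIMSEQ_A_const:
  assumes "k \<ge> 2"
  shows "(\<lambda>N. \<Prod>p\<in>primes_upto N. local_density s k (1 / real p)) \<longlonglongrightarrow> A_const s k"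
proof -
  define F where "F p = (if prime p then A_factor s k p else 1)" for p
  have F: "F p = local_density s k (1 / real p)" if "prime p" for p
    using that assms A_factor_eq_local_density[of p k s] prime_ge_2_nat[of p] by (simp add: F_def)
  have le: "norm (F p - 1) \<le> 4 ^ s * (1 / real p ^ 2)" for p
  proof (cases "prime p")
    case True
    have x: "0 \<le> 1 / real p" "1 / real p \<le> 1"
      using prime_ge_1_nat[OF True] by auto
    show ?thesis
      using one_minus_local_density_le[OF x, of 2 k s] local_density_le_1[OF x, of s k] assms
      by (simp only: F[OF True]) (simp add: power_one_over)
  qed (simp add: F_def)
  have "summable (\<lambda>p. 4 ^ s * (1 / real p ^ 2))"
    using inverse_power_summable[of 2, where 'a = real] by (intro summable_mult) (simp add: inverse_eq_divide)
  then have "summable (\<lambda>p. norm (F p - 1))"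
    by (rule summable_comparison_test'[where N = 0]) (use le in simp)
  then have "convergent_prod F"
    by (rule abs_convergent_prod_imp_convergent_prod[OF summable_imp_abs_convergent_prod])
  then have "(\<lambda>N. \<Prod>p\<le>N. F p) \<longlonglongrightarrow> A_const s k"
    unfolding A_const_def F_def[symmetric] by (rule convergent_prod_LIMSEQ)
  moreover have "(\<Prod>p\<le>N. F p) = (\<Prod>p\<in>primes_upto N. local_density s k (1 / real p))" for N
  proof -
    have "(\<Prod>p\<le>N. F p) = (\<Prod>p\<in>primes_upto N. F p)"
      by (intro prod.mono_neutral_right) (auto simp: primes_upto_def F_def)
    also have "\<dots> = (\<Prod>p\<in>primes_upto N. local_density s k (1 / real p))"
      by (intro prod.cong refl F) (auto simp: primes_upto_def)
    finally show ?thesis .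
  qed
  ultimately show ?thesis by simp
qed

subsection \<open>Thresholds\<close>

text \<open>A tuple is admissible iff every prime \<open>p\<close> divides fewer than \<open>threshold k u p\<close> of its entries.\<close>

definition threshold :: "nat \<Rightarrow> (nat \<Rightarrow> nat) \<Rightarrow> nat \<Rightarrow> nat" where
  "threshold k u p = (if \<exists>i\<in>{1..k - 1}. p dvd u i then LEAST i. i \<in> {1..k - 1} \<and> p dvd u i else k)"

lemma threshold_cases:
  assumes "k \<ge> 1"
  obtains "threshold k u p \<in> {1..k - 1}" "p dvd u (threshold k u p)"
  | "threshold k u p = k" "\<And>i. i \<in> {1..k - 1} \<Longrightarrow> \<not> p dvd u i"
proof (cases "\<exists>i\<in>{1..k - 1}. p dvd u i")
  case True
  then have "(LEAST i. i \<in> {1..k - 1} \<and> p dvd u i) \<in> {1..k - 1} \<and> p dvd u (LEAST i. i \<in> {1..k - 1} \<and> p dvd u i)"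
    by (intro LeastI_ex[of "\<lambda>i. i \<in> {1..k - 1} \<and> p dvd u i"]) blast
  then show ?thesis using that(1) True by (simp add: threshold_def)
next
  case False
  then show ?thesis using that(2) by (auto simp: threshold_def)
qed

lemma threshold_ge_1:
  assumes "k \<ge> 1"
  shows "threshold k u p \<ge> 1"
  using assms by (cases rule: threshold_cases[OF assms, of u p]) auto

definition pairwise_coprime_family :: "nat \<Rightarrow> (nat \<Rightarrow> nat) \<Rightarrow> bool" where
  "pairwise_coprime_family k u \<longleftrightarrow>
    (\<forall>i\<in>{1..k - 1}. u i \<ge> 1) \<and> (\<forall>i\<in>{1..k - 1}. \<forall>j\<in>{1..k - 1}. i \<noteq> j \<longrightarrow> gcd (u i) (u j) = 1)"

text \<open>Coprimality leaves only one index whose \<open>u i\<close> is divisible by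
  \<open>p\<close>, so \<open>LEAST\<close> has no choice.\<close>

lemma threshold_eq:
  assumes "pairwise_coprime_family k u" "prime p" "i \<in> {1..k - 1}" "p dvd u i"
  shows "threshold k u p = i"
proof -
  have "k \<ge> 1" using assms(3) by auto
  then show ?thesis
  proof (cases rule: threshold_cases[of k u p])
    case 1
    show ?thesis
    proof (rule ccontr)
      assume "threshold k u p \<noteq> i"
      then have "gcd (u (threshold k u p)) (u i) = 1"
        using assms 1 by (auto simp: pairwise_coprime_family_def)
      moreover have "p dvd gcd (u (threshold k u p)) (u i)"
        using 1 assms by simp
      ultimately show False using assms(2) by auto
    qed
  qed (use assms in auto)
qed

text \<open>\<open>p\<close> divides the gcd over \<open>I\<close> iff \<open>I\<close> consists of
  indices of multiples of \<open>p\<close>, and there is such an \<open>I\<close> of size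
  \<open>i\<close> iff there are at least \<open>i\<close> such indices.\<close>

lemma all_subsets_not_dvd_Gcd_iff:
  fixes a :: "nat \<Rightarrow> nat"
  shows "(\<forall>I\<subseteq>{1..s}. card I = i \<longrightarrow> \<not> p dvd Gcd (a ` I)) \<longleftrightarrow> card {j \<in> {1..s}. p dvd a j} < i"
proof
  assume *: "\<forall>I\<subseteq>{1..s}. card I = i \<longrightarrow> \<not> p dvd Gcd (a ` I)"
  show "card {j \<in> {1..s}. p dvd a j} < i"
  proof (rule ccontr)
    assume "\<not> card {j \<in> {1..s}. p dvd a j} < i"
    then obtain I where "I \<subseteq> {j \<in> {1..s}. p dvd a j}" "card I = i"
      using obtain_subset_with_card_n[of i "{j \<in> {1..s}. p dvd a j}"] by auto
    moreover from this have "p dvd Gcd (a ` I)"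
      by (intro Gcd_greatest) auto
    moreover from calculation have "I \<subseteq> {1..s}" by auto
    ultimately show False using * by blast
  qed
next
  assume *: "card {j \<in> {1..s}. p dvd a j} < i"
  show "\<forall>I\<subseteq>{1..s}. card I = i \<longrightarrow> \<not> p dvd Gcd (a ` I)"
  proof (intro allI impI notI)
    fix I assume I: "I \<subseteq> {1..s}" "card I = i" "p dvd Gcd (a ` I)"
    then have "I \<subseteq> {j \<in> {1..s}. p dvd a j}"
      by (auto dest: dvd_trans intro: Gcd_dvd)
    then have "card I \<le> card {j \<in> {1..s}. p dvd a j}"
      by (intro card_mono) auto
    then show False using I * by simp
  qed
qed

lemma wise_coprime_iff:
  "wise_coprime k s a \<longleftrightarrow> (\<forall>p. prime p \<longrightarrow> card {j \<in> {1..s}. p dvd a j} < k)"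
proof -
  have "x = 1 \<longleftrightarrow> (\<forall>p. prime p \<longrightarrow> \<not> p dvd x)" for x :: nat
    using prime_factor_nat[of x] by auto
  then show ?thesis
    unfolding wise_coprime_def all_subsets_not_dvd_Gcd_iff[symmetric] by metis
qed

lemma wise_coprime_to_iff:
  "wise_coprime_to i s a c \<longleftrightarrow> (\<forall>p. prime p \<longrightarrow> p dvd c \<longrightarrow> card {j \<in> {1..s}. p dvd a j} < i)"
proof -
  have "coprime x c \<longleftrightarrow> (\<forall>p. prime p \<longrightarrow> p dvd c \<longrightarrow> \<not> p dvd x)" for x :: nat
  proof
    assume "coprime x c"
    then show "\<forall>p. prime p \<longrightarrow> p dvd c \<longrightarrow> \<not> p dvd x"
      by (meson coprime_common_divisor not_prime_unit)
  next
    assume "\<forall>p. prime p \<longrightarrow> p dvd c \<longrightarrow> \<not> p dvd x"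
    then have "gcd x c = 1"
      using prime_factor_nat[of "gcd x c"] by auto
    then show "coprime x c" by (simp add: coprime_iff_gcd_eq_1)
  qed
  then show ?thesis
    unfolding wise_coprime_to_def all_subsets_not_dvd_Gcd_iff[symmetric] by metis
qed

text \<open>A prime above \<open>n\<close> divides no entry between 1 and \<open>n\<close>, so its
  condition holds because thresholds are at least 1; only finitely many conditions remain.
  Thresholds never exceed \<open>k\<close>, which gives back \<open>k\<close>-wise
  coprimality.\<close>

lemma Q_count_eq:
  assumes "pairwise_coprime_family k u" "k \<ge> 1"
  shows "Q_count s k u n = card {a \<in> {1..s} \<rightarrow>\<^sub>E {1..n}.
    \<forall>p\<in>primes_upto n. card {j \<in> {1..s}. p dvd a j} < threshold k u p}"
proof -
  have "(wise_coprime k s a \<and> (\<forall>i\<in>{1..k - 1}. wise_coprime_to i s a (u i))) \<longleftrightarrow>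
    (\<forall>p\<in>primes_upto n. card {j \<in> {1..s}. p dvd a j} < threshold k u p)" (is "?L \<longleftrightarrow> ?R")
    if a: "a \<in> {1..s} \<rightarrow>\<^sub>E {1..n}" for a
  proof
    assume L: ?L
    show ?R
    proof
      fix p assume "p \<in> primes_upto n"
      then have "prime p" by (simp add: primes_upto_def)
      then show "card {j \<in> {1..s}. p dvd a j} < threshold k u p"
        using L by (cases rule: threshold_cases[OF assms(2), of u p])
          (auto simp: wise_coprime_iff wise_coprime_to_iff)
    qed
  next
    assume R: ?R
    have lt: "card {j \<in> {1..s}. p dvd a j} < threshold k u p" if p: "prime p" for p
    proof (cases "p \<le> n")
      case True
      then show ?thesis using R p by (simp add: primes_upto_def)
    next
      case False
      have "\<not> p dvd a j" if "j \<in> {1..s}" for j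
      proof -
        have "a j \<in> {1..n}" using a that by (auto simp: PiE_iff)
        then show ?thesis using False by (auto dest!: dvd_imp_le)
      qed
      then have "{j \<in> {1..s}. p dvd a j} = {}" by auto
      then show ?thesis using threshold_ge_1[OF assms(2), of u p] by (simp only: card.empty)
    qed
    have "threshold k u p \<le> k" for p
      by (rule threshold_cases[OF assms(2), of u p]) auto
    then have "wise_coprime k s a"
      unfolding wise_coprime_iff using lt less_le_trans by blast
    moreover have "wise_coprime_to i s a (u i)" if "i \<in> {1..k - 1}" for i
      unfolding wise_coprime_to_iff using lt threshold_eq[OF assms(1) _ that] by metis
    ultimately show ?L by blast
  qed
  then show ?thesis
    unfolding Q_count_def by (intro arg_cong[where f = card]) auto
qed

text \<open>The sets of prime factors of the \<open>u i\<close> are disjoint, so every prime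
  dividing some \<open>u i\<close> has its density exchanged exactly once. At all other primes up to
  \<open>N\<close> the threshold is \<open>k\<close> and the ratio is 1.\<close>

lemma prod_f_factor_eq:
  assumes "pairwise_coprime_family k u" "k \<ge> 2"
    and N: "\<And>i p. i \<in> {1..k - 1} \<Longrightarrow> p \<in> prime_factors (u i) \<Longrightarrow> p \<le> N"
  shows "(\<Prod>p\<in>primes_upto N. local_density s k (1 / real p)) * (\<Prod>i = 1..k - 1. f_factor s k i (u i))
    = (\<Prod>p\<in>primes_upto N. local_density s (threshold k u p) (1 / real p))"
proof -
  let ?U = "\<Union>i\<in>{1..k - 1}. prime_factors (u i)"
  let ?\<rho> = "\<lambda>i p. local_density s i (1 / real p)"
  have k: "k \<ge> 1" using assms(2) by simp
  have pf: "prime p \<and> p dvd u i" if "p \<in> prime_factors (u i)" for p i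
    using that by auto
  have "(\<Prod>i = 1..k - 1. f_factor s k i (u i)) = (\<Prod>i = 1..k - 1. \<Prod>p\<in>prime_factors (u i). ?\<rho> (threshold k u p) p / ?\<rho> k p)"
  proof (intro prod.cong refl)
    fix i assume i: "i \<in> {1..k - 1}"
    then have "f_factor s k i (u i) = (\<Prod>p\<in>prime_factors (u i). ?\<rho> i p / ?\<rho> k p)"
      by (intro f_factor_eq_local_density) auto
    also have "\<dots> = (\<Prod>p\<in>prime_factors (u i). ?\<rho> (threshold k u p) p / ?\<rho> k p)"
      using threshold_eq[OF assms(1) _ i] pf by (intro prod.cong) auto
    finally show "f_factor s k i (u i) = (\<Prod>p\<in>prime_factors (u i). ?\<rho> (threshold k u p) p / ?\<rho> k p)" .
  qed
  also have "\<dots> = (\<Prod>p\<in>?U. ?\<rho> (threshold k u p) p / ?\<rho> k p)"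
  proof (rule prod.UNION_disjoint[symmetric])
    show "\<forall>i\<in>{1..k - 1}. \<forall>j\<in>{1..k - 1}. i \<noteq> j \<longrightarrow> prime_factors (u i) \<inter> prime_factors (u j) = {}"
      using threshold_eq[OF assms(1)] pf by (metis disjoint_iff)
  qed auto
  also have "\<dots> = (\<Prod>p\<in>primes_upto N. ?\<rho> (threshold k u p) p / ?\<rho> k p)"
  proof (rule prod.mono_neutral_left)
    show "?U \<subseteq> primes_upto N" using N by (auto simp: primes_upto_def)
    show "\<forall>p\<in>primes_upto N - ?U. ?\<rho> (threshold k u p) p / ?\<rho> k p = 1"
    proof
      fix p assume p: "p \<in> primes_upto N - ?U"
      then have "prime p" by (auto simp: primes_upto_def)
      have "\<not> p dvd u i" if "i \<in> {1..k - 1}" for i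
      proof -
        have "u i \<ge> 1"
          using assms(1) that unfolding pairwise_coprime_family_def by blast
        moreover have "p \<notin> prime_factors (u i)"
          using p that by blast
        ultimately show ?thesis
          using \<open>prime p\<close> by (simp add: in_prime_factors_iff)
      qed
      then have "threshold k u p = k"
        by (cases rule: threshold_cases[OF k, of u p]) auto
      then show "?\<rho> (threshold k u p) p / ?\<rho> k p = 1"
        using local_density_pos[of p k s] prime_ge_2_nat[OF \<open>prime p\<close>] k by simp
    qed
  qed auto
  finally have "(\<Prod>p\<in>primes_upto N. ?\<rho> k p) * (\<Prod>i = 1..k - 1. f_factor s k i (u i))
      = (\<Prod>p\<in>primes_upto N. ?\<rho> k p * (?\<rho> (threshold k u p) p / ?\<rho> k p))"
    by (simp only: prod.distrib)
  also have "\<dots> = (\<Prod>p\<in>primes_upto N. ?\<rho> (threshold k u p) p)"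
  proof (intro prod.cong refl)
    fix p assume "p \<in> primes_upto N"
    then have "?\<rho> k p > 0"
      using k by (intro local_density_pos) (auto simp: primes_upto_def prime_ge_2_nat)
    then show "?\<rho> k p * (?\<rho> (threshold k u p) p / ?\<rho> k p) = ?\<rho> (threshold k u p) p" by simp
  qed
  finally show ?thesis .
qed

section \<open>The tail of the Euler product\<close>

lemma two_power_card_threshold_le_theta:
  assumes "pairwise_coprime_family k u" "k \<ge> 2"
  shows "2 ^ card {p \<in> primes_upto N. threshold k u p = 1} \<le> theta (u 1)"
proof (rule two_power_card_le_theta)
  have "1 \<in> {1..k - 1}" using assms(2) by auto
  then have "u 1 \<ge> 1"
    using assms(1) unfolding pairwise_coprime_family_def by blast
  then show "u 1 > 0" by simp
  fix p assume p: "p \<in> {p \<in> primes_upto N. threshold k u p = 1}"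
  have "k \<ge> 1" using assms by simp
  then show "prime p \<and> p dvd u 1"
    using p assms(2) by (cases rule: threshold_cases[of k u p]) (auto simp: primes_upto_def)
qed simp

text \<open>Primes between \<open>n\<close> and \<open>N\<close> of threshold at least 2 change the
  product by \<open>O(1 / p ^ 2)\<close> each, in total \<open>O(1 / n)\<close>. Those of threshold
  1 cost \<open>O(1 / n)\<close> each, and there are fewer than \<open>theta (u 1)\<close> of
  them.\<close>

lemma prod_local_density_tail:
  assumes "pairwise_coprime_family k u" "k \<ge> 2" "1 \<le> n" "n \<le> N"
  shows "\<bar>(\<Prod>p\<in>primes_upto n. local_density s (threshold k u p) (1 / real p))
    - (\<Prod>p\<in>primes_upto N. local_density s (threshold k u p) (1 / real p))\<bar>
    \<le> 2 * 4 ^ s * real (theta (u 1)) / real n"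
proof -
  let ?\<rho> = "\<lambda>p. local_density s (threshold k u p) (1 / real p)"
  let ?R = "{p. prime p \<and> n < p \<and> p \<le> N}"
  let ?D = "{p \<in> primes_upto N. threshold k u p = 1}"
  have finR: "finite ?R" by (rule finite_subset[of _ "{..N}"]) auto
  have k: "k \<ge> 1" using assms(2) by simp
  have x: "0 \<le> 1 / real p \<and> 1 / real p \<le> 1" if "prime p" for p
    using prime_ge_1_nat[OF that] by simp
  have \<rho>: "0 \<le> ?\<rho> p \<and> ?\<rho> p \<le> 1" if "prime p" for p
    using x[OF that] local_density_nonneg local_density_le_1 by blast
  have card_D: "real (card ?D) + 1 \<le> real (theta (u 1))"
  proof -
    have "card ?D + 1 \<le> 2 ^ card ?D"
      using less_exp[of "card ?D"] by (simp add: Suc_le_eq)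
    also have "\<dots> \<le> theta (u 1)"
      using assms by (intro two_power_card_threshold_le_theta)
    finally show ?thesis by (metis of_nat_1 of_nat_add of_nat_le_iff)
  qed
  have split: "primes_upto N = primes_upto n \<union> ?R"
    using assms by (auto simp: primes_upto_def)
  have "(\<Prod>p\<in>primes_upto N. ?\<rho> p) = (\<Prod>p\<in>primes_upto n. ?\<rho> p) * (\<Prod>p\<in>?R. ?\<rho> p)"
    unfolding split using finR by (intro prod.union_disjoint) (auto simp: primes_upto_def)
  then have "\<bar>(\<Prod>p\<in>primes_upto n. ?\<rho> p) - (\<Prod>p\<in>primes_upto N. ?\<rho> p)\<bar>
      = \<bar>\<Prod>p\<in>primes_upto n. ?\<rho> p\<bar> * \<bar>1 - (\<Prod>p\<in>?R. ?\<rho> p)\<bar>"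
    by (simp flip: abs_mult add: algebra_simps)
  \<comment> \<open>The head is at most 1, and Weierstrass' product inequality bounds the deviation
    of the tail product from 1 by the sum of the deviations of its factors.\<close>
  also have "\<dots> \<le> 1 * (\<Sum>p\<in>?R. 1 - ?\<rho> p)"
  proof (rule mult_mono)
    show "\<bar>\<Prod>p\<in>primes_upto n. ?\<rho> p\<bar> \<le> 1"
      unfolding abs_prod using \<rho> by (intro prod_le_1) (auto simp: primes_upto_def)
    have "1 - (\<Sum>p\<in>?R. 1 - ?\<rho> p) \<le> (\<Prod>p\<in>?R. 1 - (1 - ?\<rho> p))"
      using \<rho> by (intro Weierstrass_prod_ineq) auto
    moreover have "(\<Prod>p\<in>?R. ?\<rho> p) \<le> 1"
      using \<rho> by (intro prod_le_1) auto
    ultimately show "\<bar>1 - (\<Prod>p\<in>?R. ?\<rho> p)\<bar> \<le> (\<Sum>p\<in>?R. 1 - ?\<rho> p)" by simp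
  qed auto
  also have "\<dots> \<le> (\<Sum>p\<in>?R. 4 ^ s * (of_bool (p \<in> ?D) / real n + 1 / real p ^ 2))"
    unfolding mult_1
  proof (rule sum_mono)
    fix p assume p: "p \<in> ?R"
    have x': "0 \<le> 1 / real p" "1 / real p \<le> 1" using x p by auto
    show "1 - ?\<rho> p \<le> 4 ^ s * (of_bool (p \<in> ?D) / real n + 1 / real p ^ 2)"
    proof (cases "threshold k u p = 1")
      case True
      have "1 - ?\<rho> p \<le> 4 ^ s * (1 / real p) ^ 1"
        using True by (intro one_minus_local_density_le x') auto
      also have "\<dots> \<le> 4 ^ s * (1 / real n + 1 / real p ^ 2)"
      proof (rule mult_left_mono)
        have "1 / real p \<le> 1 / real n"
          using p assms(3) by (intro divide_left_mono) auto
        then show "(1 / real p) ^ 1 \<le> 1 / real n + 1 / real p ^ 2"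
          by (simp add: add_increasing2)
      qed simp
      finally show ?thesis using True p by (simp add: primes_upto_def)
    next
      case False
      then have "1 - ?\<rho> p \<le> 4 ^ s * (1 / real p) ^ 2"
        using threshold_ge_1[OF k, of u p] by (intro one_minus_local_density_le x') auto
      then show ?thesis using False by (simp add: power_one_over)
    qed
  qed
  also have "\<dots> = 4 ^ s * ((\<Sum>p\<in>?R. of_bool (p \<in> ?D) / real n) + (\<Sum>p\<in>?R. 1 / real p ^ 2))"
    by (simp only: sum.distrib sum_distrib_left[symmetric])
  also have "\<dots> \<le> 4 ^ s * (real (card ?D) / real n + 1 / real n)"
  proof (intro mult_left_mono add_mono)
    have "(\<Sum>p\<in>?R. of_bool (p \<in> ?D)) = real (card (?R \<inter> ?D))"
      using finR by (simp add: of_bool_def sum.If_cases Int_def)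
    also have "\<dots> \<le> real (card ?D)"
      by (simp add: card_mono)
    finally show "(\<Sum>p\<in>?R. of_bool (p \<in> ?D) / real n) \<le> real (card ?D) / real n"
      unfolding sum_divide_distrib[symmetric] by (rule divide_right_mono) simp
    have "(\<Sum>p\<in>?R. 1 / real p ^ 2) \<le> (\<Sum>m\<in>{n<..N}. 1 / real m ^ 2)"
      by (intro sum_mono2) auto
    also have "\<dots> \<le> 1 / real n - 1 / real N"
      using assms by (intro sum_inverse_squares_le)
    also have "\<dots> \<le> 1 / real n" by simp
    finally show "(\<Sum>p\<in>?R. 1 / real p ^ 2) \<le> 1 / real n" .
  qed simp
  also have "\<dots> = 4 ^ s * ((real (card ?D) + 1) / real n)"
    by (simp add: add_divide_distrib)
  also have "\<dots> \<le> 4 ^ s * (2 * real (theta (u 1)) / real n)"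
    using card_D by (intro mult_left_mono divide_right_mono) auto
  also have "\<dots> = 2 * 4 ^ s * real (theta (u 1)) / real n"
    by simp
  finally show ?thesis .
qed

text \<open>Once \<open>N\<close> exceeds \<open>n\<close> and all prime factors of the
  \<open>u i\<close>, the tail bound applies with a right-hand side free of \<open>N\<close>; then
  \<open>N\<close> tends to infinity.\<close>

lemma A_const_prod_f_factor_diff_le:
  assumes "pairwise_coprime_family k u" "k \<ge> 2" "1 \<le> n"
  shows "\<bar>(\<Prod>p\<in>primes_upto n. local_density s (threshold k u p) (1 / real p))
    - A_const s k * (\<Prod>i = 1..k - 1. f_factor s k i (u i))\<bar> \<le> 2 * 4 ^ s * real (theta (u 1)) / real n"
proof (rule LIMSEQ_le_const2)
  let ?c = "\<Prod>p\<in>primes_upto n. local_density s (threshold k u p) (1 / real p)"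
  let ?f = "\<Prod>i = 1..k - 1. f_factor s k i (u i)"
  show "(\<lambda>N. \<bar>?c - (\<Prod>p\<in>primes_upto N. local_density s k (1 / real p)) * ?f\<bar>)
      \<longlonglongrightarrow> \<bar>?c - A_const s k * ?f\<bar>"
    by (intro tendsto_intros LIMSEQ_A_const assms)
  define U where "U = (\<Union>i\<in>{1..k - 1}. prime_factors (u i))"
  have "finite U" by (simp add: U_def)
  then obtain M where M: "\<And>p. p \<in> U \<Longrightarrow> p \<le> M"
    using finite_nat_set_iff_bounded_le[of U] by blast
  show "\<exists>M. \<forall>N\<ge>M. \<bar>?c - (\<Prod>p\<in>primes_upto N. local_density s k (1 / real p)) * ?f\<bar>
      \<le> 2 * 4 ^ s * real (theta (u 1)) / real n"
  proof (intro exI allI impI)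
    fix N assume N: "N \<ge> max M n"
    then have "(\<Prod>p\<in>primes_upto N. local_density s k (1 / real p)) * ?f
      = (\<Prod>p\<in>primes_upto N. local_density s (threshold k u p) (1 / real p))"
      using M by (intro prod_f_factor_eq assms) (force simp: U_def)
    then show "\<bar>?c - (\<Prod>p\<in>primes_upto N. local_density s k (1 / real p)) * ?f\<bar>
        \<le> 2 * 4 ^ s * real (theta (u 1)) / real n"
      using prod_local_density_tail[OF assms, of N s] N by simp
  qed
qed

section \<open>Assembling the error term\<close>

lemma Q_count_estimate:
  assumes "pairwise_coprime_family k u" "k \<ge> 2"
  shows "\<bar>real (Q_count s k u n) - real n ^ s * (\<Prod>p\<in>primes_upto n. local_density s (threshold k u p) (1 / real p))\<bar>
    \<le> real n ^ (s - 1) * (real s * (real (theta (u 1)) * (3 * exp 4 * log_ge2 n) ^ (s - 1) * exp (2 * 4 ^ s)))"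
proof -
  let ?P = "primes_upto n"
  let ?t = "threshold k u"
  let ?B = "real (theta (u 1)) * (3 * exp 4 * log_ge2 n) ^ (s - 1) * exp (2 * 4 ^ s)"
  have k: "k \<ge> 1" using assms by simp
  have "\<bar>real (Q_count s k u n) - real n ^ s * (\<Prod>p\<in>?P. local_density s (?t p) (1 / real p))\<bar>
    \<le> real n ^ (s - 1) * (\<Sum>j\<in>{1..s}. \<Prod>p\<in>?P. \<Sum>T\<in>Pow {1..s}. \<bar>sieve_coeff (?t p) T\<bar> * (1 / real p) ^ card (T - {j}))"
    unfolding Q_count_eq[OF assms(1) k] by (rule sieve_count_estimate) (simp_all add: primes_upto_def)
  also have "\<dots> \<le> real n ^ (s - 1) * (\<Sum>j\<in>{1..s}. ?B)"
  proof (intro mult_left_mono sum_mono)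
    fix j assume j: "j \<in> {1..s}"
    have "real (2 ^ card {p \<in> ?P. ?t p = 1}) \<le> real (theta (u 1))"
      using two_power_card_threshold_le_theta[OF assms] by (simp only: of_nat_le_iff)
    then have "2 ^ card {p \<in> ?P. ?t p = 1} * (3 * exp 4 * log_ge2 n) ^ (s - 1) * exp (2 * 4 ^ s) \<le> ?B"
      by (intro mult_right_mono) (auto simp: log_ge2_def)
    then show "(\<Prod>p\<in>?P. \<Sum>T\<in>Pow {1..s}. \<bar>sieve_coeff (?t p) T\<bar> * (1 / real p) ^ card (T - {j})) \<le> ?B"
      by (rule order_trans[OF prod_sum_abs_sieve_coeff_le[OF j threshold_ge_1[OF k]]])
  qed simp
  finally show ?thesis by simp
qed

text \<open>The term \<open>i = 1\<close> of the maximum is \<open>s - 1\<close>, the power of the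
  logarithm that the sieve produces.\<close>

lemma delta_exp_ge: "k \<ge> 2 \<Longrightarrow> s - 1 \<le> delta_exp s k"
proof -
  assume "k \<ge> 2"
  then have "(s - 1) choose 1 \<le> delta_exp s k"
    unfolding delta_exp_def by (intro Max_ge imageI) auto
  then show ?thesis by simp
qed

text \<open>\<open>log_ge2 n\<close> is below 1 for \<open>n\<close> at most 2, so its powers need
  not increase with the exponent; those of \<open>2 * log_ge2 n\<close> do, since this is at least
  1.\<close>

lemma log_ge2_power_le:
  assumes "e \<le> d"
  shows "log_ge2 n ^ e \<le> 2 ^ d * log_ge2 n ^ d"
proof -
  have "1 / 2 \<le> ln (2::real)"
    using ln_le_minus_one[of "1/2::real"] by (simp add: ln_div)
  also have "\<dots> \<le> log_ge2 n" by (simp add: log_ge2_def)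
  finally have L: "1 / 2 \<le> log_ge2 n" .
  then have "log_ge2 n ^ e \<le> (2 * log_ge2 n) ^ e"
    by (intro power_mono) auto
  also have "\<dots> \<le> (2 * log_ge2 n) ^ d"
    using L assms by (intro power_increasing) auto
  finally show ?thesis by (simp add: power_mult_distrib)
qed

theorem theorem1:
  fixes s k :: nat
  assumes "s \<ge> 1" and "k \<ge> 2"
  shows "\<exists>C::real. \<forall>(n::nat) (u::nat \<Rightarrow> nat).
    n \<ge> 1 \<and> (\<forall>i \<in> {1..k - 1}. u i \<ge> 1) \<and>
    (\<forall>i \<in> {1..k - 1}. \<forall>j \<in> {1..k - 1}. i \<noteq> j \<longrightarrow> gcd (u i) (u j) = 1) \<longrightarrow>
    \<bar>real (Q_count s k u n) - A_const s k * (\<Prod>i = 1..k - 1. f_factor s k i (u i)) * real n ^ s\<bar>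
      \<le> C * (real (theta (u 1)) * real n ^ (s - 1) * log_ge2 n ^ delta_exp s k)"
proof -
  \<comment> \<open>The constant of \<open>Q_count_estimate\<close> with the power of
    \<open>log_ge2 n\<close> split off.\<close>
  define K :: real where "K = real s * (3 * exp 4) ^ (s - 1) * exp (2 * 4 ^ s)"
  define d where "d = delta_exp s k"
  have K: "K \<ge> 0" by (simp add: K_def)
  show ?thesis
  proof (intro exI allI impI)
    fix n :: nat and u :: "nat \<Rightarrow> nat"
    assume "n \<ge> 1 \<and> (\<forall>i \<in> {1..k - 1}. u i \<ge> 1) \<and>
      (\<forall>i \<in> {1..k - 1}. \<forall>j \<in> {1..k - 1}. i \<noteq> j \<longrightarrow> gcd (u i) (u j) = 1)"
    then have n: "n \<ge> 1" and u: "pairwise_coprime_family k u"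
      by (auto simp: pairwise_coprime_family_def)
    let ?\<theta> = "real (theta (u 1))" and ?L = "log_ge2 n"
    let ?Q = "real (Q_count s k u n)"
    let ?c = "\<Prod>p\<in>primes_upto n. local_density s (threshold k u p) (1 / real p)"
    let ?Af = "A_const s k * (\<Prod>i = 1..k - 1. f_factor s k i (u i))"
    have ns: "real n ^ s = real n * real n ^ (s - 1)"
      using assms(1) by (simp flip: power_Suc)
    \<comment> \<open>The first part is the sieve error, the second comes from completing the finite
      product of densities.\<close>
    have "\<bar>?Q - ?Af * real n ^ s\<bar> = \<bar>(?Q - real n ^ s * ?c) + real n ^ s * (?c - ?Af)\<bar>"
      by (simp add: algebra_simps)
    also have "\<dots> \<le> \<bar>?Q - real n ^ s * ?c\<bar> + real n ^ s * \<bar>?c - ?Af\<bar>"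
      by (rule order_trans[OF abs_triangle_ineq]) (simp add: abs_mult)
    \<comment> \<open>The factor \<open>?L ^ 0\<close> lets \<open>log_ge2_power_le\<close> raise
      both exponents to \<open>d\<close> in the same way.\<close>
    also have "\<dots> \<le> ?\<theta> * real n ^ (s - 1) * (K * ?L ^ (s - 1))
        + ?\<theta> * real n ^ (s - 1) * (2 * 4 ^ s * ?L ^ 0)"
    proof (rule add_mono)
      show "\<bar>?Q - real n ^ s * ?c\<bar> \<le> ?\<theta> * real n ^ (s - 1) * (K * ?L ^ (s - 1))"
        using Q_count_estimate[OF u assms(2), of s n]
        by (simp add: K_def power_mult_distrib mult_ac)
      have "real n ^ s * \<bar>?c - ?Af\<bar> \<le> real n ^ s * (2 * 4 ^ s * ?\<theta> / real n)"
        by (intro mult_left_mono A_const_prod_f_factor_diff_le u assms n) auto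
      also have "\<dots> = ?\<theta> * real n ^ (s - 1) * (2 * 4 ^ s * ?L ^ 0)"
        using n by (simp add: ns)
      finally show "real n ^ s * \<bar>?c - ?Af\<bar> \<le> ?\<theta> * real n ^ (s - 1) * (2 * 4 ^ s * ?L ^ 0)" .
    qed
    also have "\<dots> \<le> ?\<theta> * real n ^ (s - 1) * (K * (2 ^ d * ?L ^ d))
        + ?\<theta> * real n ^ (s - 1) * (2 * 4 ^ s * (2 ^ d * ?L ^ d))"
      using K delta_exp_ge[OF assms(2), of s]
      by (intro add_mono mult_left_mono log_ge2_power_le) (auto simp: d_def)
    also have "\<dots> = (K + 2 * 4 ^ s) * 2 ^ d * (?\<theta> * real n ^ (s - 1) * ?L ^ d)"
      by (simp add: algebra_simps)
    finally show "\<bar>?Q - ?Af * real n ^ s\<bar>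
        \<le> (K + 2 * 4 ^ s) * 2 ^ delta_exp s k * (?\<theta> * real n ^ (s - 1) * ?L ^ delta_exp s k)"
      by (simp add: d_def)
  qed
qed

end
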